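(* Suppose that $D\subsetneq \mathbb{R}^n$ is a $\varphi$-uniform domain and $x_0\in D$. Let $\{x_k\}_{k=1}^{\infty}$ be a sequence of points in $B^n(x_0,\delta_D(x_0))$ satisfying $x_k\in[x_0,x_{k-1})$ (for $k\ge 2$) and $|x_0-x_k|=\frac{1}{2^{k+2}}\delta_D(x_0)$. Denote $E=\{x_0\}\cup\{x_k\}_{k=1}^{\infty}$. Then $D\setminus E$ is $\psi$-uniform with $\psi$ depending on $\varphi$.
   Context: Throughout $n\ge 2$; a domain is an open connected non-empty subset of $\mathbb{R}^n$. $B^n(x,r)$ is the open Euclidean ball with center $x$ and radius $r$; $[a,b)$ is the half-open Euclidean segment from $a$ to $b$ (containing $a$, not $b$). For a domain $G\subsetneq\mathbb{R}^n$ and $x\in G$, $\delta_G(x)$ is the Euclidean distance from $x$ to $\partial G$. The quasihyperbolic metric of $G$ is $k_G(x,y)=\inf_{\gamma}\int_\gamma \frac{|dz|}{\delta_G(z)}$, the infimum being over all rectifiable paths $\gamma\subset G$ joining $x$ and $y$. For a homeomorphism $\varphi:[0,\infty)\to[0,\infty)$, a domain $G\subsetneq\mathbb{R}^n$ is called $\varphi$-uniform if $k_G(x,y)\le \varphi\big(|x-y|/\min\{\delta_G(x),\delta_G(y)\}\big)$ for all $x,y\in G$ (and similarly for the homeomorphism $\psi$ of $[0,\infty)$). *)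

theory Defs
  imports "HOL-Analysis.Analysis"
begin

definition is_domain :: "'a::euclidean_space set \<Rightarrow> bool" where
  "is_domain G \<longleftrightarrow> open G \<and> connected G \<and> G \<noteq> {}"

definition bdist :: "'a::euclidean_space set \<Rightarrow> 'a \<Rightarrow> real" where
  "bdist G x = infdist x (frontier G)"

definition chord_sums :: "(real \<Rightarrow> 'a::euclidean_space) \<Rightarrow> real \<Rightarrow> real \<Rightarrow> real set" where
  "chord_sums \<gamma> a b =
     {\<Sum>i<m. norm (\<gamma> (t (Suc i)) - \<gamma> (t i)) | (m::nat) (t::nat \<Rightarrow> real).
        t 0 = a \<and> t m = b \<and> (\<forall>i<m. t i \<le> t (Suc i))}"

definition rectifiable_path :: "(real \<Rightarrow> 'a::euclidean_space) \<Rightarrow> bool" where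
  "rectifiable_path \<gamma> \<longleftrightarrow> path \<gamma> \<and> bdd_above (chord_sums \<gamma> 0 1)"

definition arc_len :: "(real \<Rightarrow> 'a::euclidean_space) \<Rightarrow> real \<Rightarrow> real" where
  "arc_len \<gamma> u = Sup (chord_sums \<gamma> 0 u)"

text \<open>The arc-length parametrization (normal representation) of a rectifiable path, defined on the
  interval from 0 to the length of the path. The arc-length function of such a path is continuous
  and nondecreasing on the unit interval, and the path is constant on each of its level sets, so
  the preimage picked by \<^const>\<open>inv_into\<close> is irrelevant.\<close>

definition arc_param :: "(real \<Rightarrow> 'a::euclidean_space) \<Rightarrow> real \<Rightarrow> 'a" where
  "arc_param \<gamma> s = \<gamma> (inv_into {0..1} (arc_len \<gamma>) s)"

definition arc_integral :: "(real \<Rightarrow> 'a::euclidean_space) \<Rightarrow> ('a \<Rightarrow> real) \<Rightarrow> real" where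
  "arc_integral \<gamma> \<rho> = integral {0..arc_len \<gamma> 1} (\<lambda>s. \<rho> (arc_param \<gamma> s))"

definition qh_dist :: "'a::euclidean_space set \<Rightarrow> 'a \<Rightarrow> 'a \<Rightarrow> real" where
  "qh_dist G x y =
     Inf {arc_integral \<gamma> (\<lambda>z. 1 / bdist G z) | \<gamma>.
            rectifiable_path \<gamma> \<and> path_image \<gamma> \<subseteq> G \<and> pathstart \<gamma> = x \<and> pathfinish \<gamma> = y}"

definition halfline_homeo :: "(real \<Rightarrow> real) \<Rightarrow> bool" where
  "halfline_homeo \<phi> \<longleftrightarrow> (\<exists>\<phi>'. homeomorphism {0..} {0..} \<phi> \<phi>')"

definition uniform_domain :: "(real \<Rightarrow> real) \<Rightarrow> 'a::euclidean_space set \<Rightarrow> bool" where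
  "uniform_domain \<phi> G \<longleftrightarrow> is_domain G \<and> G \<noteq> UNIV \<and>
     (\<forall>x\<in>G. \<forall>y\<in>G. qh_dist G x y \<le> \<phi> (norm (x - y) / min (bdist G x) (bdist G y)))"

end

theory Submission
  imports Defs
begin

text \<open>
  Write \<open>G = D - E\<close> and \<open>d = bdist D x0\<close>. Only crude estimates are needed: a path of length \<open>L\<close> that
  stays at distance at least \<open>r\<close> from the boundary of \<open>G\<close> costs at most \<open>L / r\<close>.

  Close to \<open>x0\<close>, the set \<open>E\<close> lies on a line. Two points on the same side of that line are joined by
  pushing both away from the line and then moving along a segment, and the line itself is crossed in a
  gap of the geometric sequence, which exists at every scale.

  Globally, a bound \<open>M\<close> for the quasihyperbolic distance in \<open>D\<close> gives a chain of \<open>O(M + 1)\<close> points whose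
  consecutive distances are small compared with the distance to the boundary of \<open>D\<close>. Replacing the
  members of the chain that are close to \<open>x0\<close> by one base point at distance \<open>d / 4\<close> from \<open>x0\<close>, each step
  of the chain has bounded cost in \<open>G\<close>. This leads to \<open>\<psi> t = 8000 * (t + \<phi> t)\<close>.
\<close>

subsection \<open>Arc length\<close>

lemma chord_sumsI:
  assumes "t 0 = a" "t m = b" "\<And>i. i < m \<Longrightarrow> t i \<le> t (Suc i)"
  shows "(\<Sum>i<m. norm (\<gamma> (t (Suc i)) - \<gamma> (t i))) \<in> chord_sums \<gamma> a b"
  unfolding chord_sums_def using assms by blast

lemma chord_sumsE:
  assumes "c \<in> chord_sums \<gamma> a b"
  obtains m t where "c = (\<Sum>i<m. norm (\<gamma> (t (Suc i)) - \<gamma> (t i)))" "t 0 = a" "t m = b"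
    "\<And>i. i < m \<Longrightarrow> t i \<le> t (Suc i)"
  using assms unfolding chord_sums_def by blast

lemma partition_bounds:
  fixes t :: "nat \<Rightarrow> real"
  assumes "t 0 = a" "t m = b" "\<And>i. i < m \<Longrightarrow> t i \<le> t (Suc i)" "i \<le> m"
  shows "a \<le> t i" "t i \<le> b"
proof -
  show "a \<le> t i"
    using assms(4) by (induction i) (use assms in \<open>auto intro: order_trans\<close>)
  show "t i \<le> b"
    using assms(4)
  proof (induction rule: inc_induct)
    case base then show ?case using assms by simp
  next
    case (step n) then show ?case using assms(3)[of n] by linarith
  qed
qed

lemma chord_sums_single:
  "a \<le> b \<Longrightarrow> norm (\<gamma> b - \<gamma> a) \<in> chord_sums \<gamma> a b"
  using chord_sumsI[of "\<lambda>i. if i = 0 then a else b" a 1 b \<gamma>] by simp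

lemma sum_lessThan_add:
  fixes f :: "nat \<Rightarrow> 'b::comm_monoid_add"
  shows "(\<Sum>i<m + n. f i) = (\<Sum>i<m. f i) + (\<Sum>i<n. f (m + i))"
  by (induction n) (simp_all add: add.assoc)

lemma chord_sums_concat:
  assumes "c1 \<in> chord_sums \<gamma> a b" "c2 \<in> chord_sums \<gamma> b c"
  shows "c1 + c2 \<in> chord_sums \<gamma> a c"
proof -
  obtain m t where 1: "c1 = (\<Sum>i<m. norm (\<gamma> (t (Suc i)) - \<gamma> (t i)))" "t 0 = a" "t m = b"
    "\<And>i. i < m \<Longrightarrow> t i \<le> t (Suc i)"
    using assms(1) by (rule chord_sumsE) blast
  obtain n u where 2: "c2 = (\<Sum>i<n. norm (\<gamma> (u (Suc i)) - \<gamma> (u i)))" "u 0 = b" "u n = c"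
    "\<And>i. i < n \<Longrightarrow> u i \<le> u (Suc i)"
    using assms(2) by (rule chord_sumsE) blast
  define v where "v i = (if i \<le> m then t i else u (i - m))" for i
  have v: "v i = t i" if "i \<le> m" for i using that by (simp add: v_def)
  have v': "v (m + i) = u i" for i using 1(3) 2(2) by (cases i) (simp_all add: v_def)
  have "v i \<le> v (Suc i)" if "i < m + n" for i
  proof (cases "i < m")
    case True then show ?thesis using 1(4) v by simp
  next
    case False
    then have "i = m + (i - m)" "i - m < n" using that by auto
    then obtain j where "i = m + j" "j < n" by blast
    then show ?thesis using 2(4)[of j] v'[of j] v'[of "Suc j"] by simp
  qed
  then have "(\<Sum>i<m + n. norm (\<gamma> (v (Suc i)) - \<gamma> (v i))) \<in> chord_sums \<gamma> a c"
    using v[of 0] v'[of n] 1(2) 2(3) by (intro chord_sumsI) auto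
  moreover have "(\<Sum>i<m + n. norm (\<gamma> (v (Suc i)) - \<gamma> (v i))) = c1 + c2"
    unfolding sum_lessThan_add 1(1) 2(1) using v v' by (simp flip: add_Suc_right)
  ultimately show ?thesis by simp
qed

text \<open>Truncating the partition at \<open>b\<close> from above and from below yields partitions
  of the two pieces. Only the step straddling \<open>b\<close> changes, and there the triangle
  inequality applies.\<close>

lemma chord_sums_split:
  assumes "c \<in> chord_sums \<gamma> a e" "a \<le> b" "b \<le> e"
  shows "\<exists>c1\<in>chord_sums \<gamma> a b. \<exists>c2\<in>chord_sums \<gamma> b e. c \<le> c1 + c2"
proof -
  obtain m t where 1: "c = (\<Sum>i<m. norm (\<gamma> (t (Suc i)) - \<gamma> (t i)))" "t 0 = a" "t m = e"
    "\<And>i. i < m \<Longrightarrow> t i \<le> t (Suc i)"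
    using assms(1) by (rule chord_sumsE) blast
  let ?l = "\<lambda>i. min (t i) b" and ?r = "\<lambda>i. max (t i) b"
  have "(\<Sum>i<m. norm (\<gamma> (?l (Suc i)) - \<gamma> (?l i))) \<in> chord_sums \<gamma> a b"
    using 1 assms by (intro chord_sumsI) (auto intro: min.coboundedI1)
  moreover have "(\<Sum>i<m. norm (\<gamma> (?r (Suc i)) - \<gamma> (?r i))) \<in> chord_sums \<gamma> b e"
    using 1 assms by (intro chord_sumsI) (auto intro: max.coboundedI1)
  moreover have "norm (\<gamma> (t (Suc i)) - \<gamma> (t i))
      \<le> norm (\<gamma> (?l (Suc i)) - \<gamma> (?l i)) + norm (\<gamma> (?r (Suc i)) - \<gamma> (?r i))" if "i < m" for i
    using 1(4)[OF that] norm_triangle_ineq[of "\<gamma> (t (Suc i)) - \<gamma> b" "\<gamma> b - \<gamma> (t i)"]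
    by (auto simp: min_def max_def algebra_simps)
  then have "c \<le> (\<Sum>i<m. norm (\<gamma> (?l (Suc i)) - \<gamma> (?l i))) + (\<Sum>i<m. norm (\<gamma> (?r (Suc i)) - \<gamma> (?r i)))"
    unfolding 1(1) sum.distrib[symmetric] by (intro sum_mono) auto
  ultimately show ?thesis by blast
qed

text \<open>Arc length with a free starting point, so that additivity over adjacent intervals can be
  expressed.\<close>

definition variation :: "(real \<Rightarrow> 'a::euclidean_space) \<Rightarrow> real \<Rightarrow> real \<Rightarrow> real" where
  "variation \<gamma> a b = Sup (chord_sums \<gamma> a b)"

lemma arc_len_eq_variation: "arc_len \<gamma> u = variation \<gamma> 0 u"
  by (simp add: arc_len_def variation_def)

context
  fixes \<gamma> :: "real \<Rightarrow> 'a::euclidean_space"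
  assumes bdd: "bdd_above (chord_sums \<gamma> 0 1)"
begin

lemma bdd_above_chord_sums:
  assumes "0 \<le> a" "a \<le> b" "b \<le> 1"
  shows "bdd_above (chord_sums \<gamma> a b)"
proof -
  obtain K where K: "\<And>c. c \<in> chord_sums \<gamma> 0 1 \<Longrightarrow> c \<le> K" using bdd by (auto simp: bdd_above_def)
  have "c \<le> K" if "c \<in> chord_sums \<gamma> a b" for c
  proof -
    \<comment> \<open>One chord on either side extends the partition of \<open>[a, b]\<close> to one
      of the unit interval.\<close>
    have "norm (\<gamma> a - \<gamma> 0) + c + norm (\<gamma> 1 - \<gamma> b) \<in> chord_sums \<gamma> 0 1"
      using chord_sums_concat[OF chord_sums_concat[OF chord_sums_single that] chord_sums_single] assms
      by blast
    from K[OF this] show ?thesis by (smt (verit) norm_ge_zero)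
  qed
  then show ?thesis by (auto simp: bdd_above_def)
qed

lemma chord_sum_le_variation:
  assumes "0 \<le> a" "a \<le> b" "b \<le> 1" "c \<in> chord_sums \<gamma> a b"
  shows "c \<le> variation \<gamma> a b"
  unfolding variation_def using assms by (intro cSup_upper bdd_above_chord_sums) auto

lemma variation_ge_norm:
  assumes "0 \<le> a" "a \<le> b" "b \<le> 1"
  shows "norm (\<gamma> b - \<gamma> a) \<le> variation \<gamma> a b"
  using assms by (intro chord_sum_le_variation chord_sums_single) auto

lemma variation_add:
  assumes "0 \<le> a" "a \<le> b" "b \<le> c" "c \<le> 1"
  shows "variation \<gamma> a b + variation \<gamma> b c = variation \<gamma> a c"
proof (rule antisym)
  have ne: "chord_sums \<gamma> a b \<noteq> {}" "chord_sums \<gamma> b c \<noteq> {}" "chord_sums \<gamma> a c \<noteq> {}"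
    using assms chord_sums_single[of a b \<gamma>] chord_sums_single[of b c \<gamma>] chord_sums_single[of a c \<gamma>]
    by auto
  have 1: "c1 + c2 \<le> variation \<gamma> a c" if "c1 \<in> chord_sums \<gamma> a b" "c2 \<in> chord_sums \<gamma> b c" for c1 c2
    using assms that by (intro chord_sum_le_variation chord_sums_concat) auto
  have "variation \<gamma> a b \<le> variation \<gamma> a c - c2" if "c2 \<in> chord_sums \<gamma> b c" for c2
    unfolding variation_def[of \<gamma> a b] using 1 that ne by (intro cSup_least) (auto simp: algebra_simps)
  then have "variation \<gamma> b c \<le> variation \<gamma> a c - variation \<gamma> a b"
    unfolding variation_def[of \<gamma> b c] using ne by (intro cSup_least) (auto simp: algebra_simps)
  then show "variation \<gamma> a b + variation \<gamma> b c \<le> variation \<gamma> a c" by simp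
  show "variation \<gamma> a c \<le> variation \<gamma> a b + variation \<gamma> b c"
    unfolding variation_def[of \<gamma> a c]
  proof (intro cSup_least ne)
    fix s assume "s \<in> chord_sums \<gamma> a c"
    then obtain c1 c2 where "c1 \<in> chord_sums \<gamma> a b" "c2 \<in> chord_sums \<gamma> b c" "s \<le> c1 + c2"
      using chord_sums_split assms by blast
    moreover have "c1 \<le> variation \<gamma> a b" "c2 \<le> variation \<gamma> b c"
      using assms calculation by (auto intro!: chord_sum_le_variation)
    ultimately show "s \<le> variation \<gamma> a b + variation \<gamma> b c" by simp
  qed
qed

lemma variation_nonneg:
  assumes "0 \<le> a" "a \<le> b" "b \<le> 1"
  shows "0 \<le> variation \<gamma> a b"
  using variation_ge_norm[OF assms] by (smt (verit) norm_ge_zero)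

text \<open>Fix a partition whose chord sum exceeds \<open>K\<close> and truncate it at
  \<open>v\<close>. The truncated sum depends continuously on \<open>v\<close> and still bounds the
  variation up to \<open>v\<close> from below.\<close>

lemma eventually_less_variation_left:
  assumes c: "continuous_on {0..1} \<gamma>" and u: "u \<in> {0..1}" and K: "K < variation \<gamma> 0 u"
  shows "\<forall>\<^sub>F v in at u within {0..1}. K < variation \<gamma> 0 v"
proof -
  obtain s where s: "s \<in> chord_sums \<gamma> 0 u" "K < s"
    using K less_cSup_iff[OF _ bdd_above_chord_sums[of 0 u]] chord_sums_single[of 0 u \<gamma>] u
    unfolding variation_def by auto
  obtain m t where t: "s = (\<Sum>i<m. norm (\<gamma> (t (Suc i)) - \<gamma> (t i)))" "t 0 = 0" "t m = u"
    "\<And>i. i < m \<Longrightarrow> t i \<le> t (Suc i)"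
    using s(1) by (rule chord_sumsE) blast
  have tb: "0 \<le> t i" "t i \<le> u" if "i \<le> m" for i
    using partition_bounds[of t 0 m u i] t(2-4) that by auto
  define F where "F v = (\<Sum>i<m. norm (\<gamma> (min (t (Suc i)) v) - \<gamma> (min (t i) v)))" for v
  have cont: "continuous_on {0..1} (\<lambda>v. \<gamma> (min (t i) v))" if "i \<le> m" for i
    by (rule continuous_on_compose2[OF c]) (use tb[OF that] in \<open>auto intro!: continuous_intros\<close>)
  have "continuous_on {0..1} F"
    unfolding F_def using cont by (intro continuous_intros) auto
  moreover have "F u = s"
    unfolding F_def t(1) using tb by (intro sum.cong) (auto simp: min_absorb1 Suc_le_eq)
  ultimately have "(F \<longlongrightarrow> s) (at u within {0..1})"
    using u by (auto simp: continuous_on_def)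
  then have "\<forall>\<^sub>F v in at u within {0..1}. K < F v"
    using s(2) order_tendstoD(1) by blast
  moreover have "\<forall>\<^sub>F v in at u within {0..1}. v \<in> {0..1}"
    by (simp add: eventually_at_filter)
  ultimately show ?thesis
  proof eventually_elim
    case (elim v)
    have "F v \<in> chord_sums \<gamma> 0 (min u v)"
      unfolding F_def
    proof (rule chord_sumsI)
      show "min (t i) v \<le> min (t (Suc i)) v" if "i < m" for i
        using t(4)[OF that] by auto
    qed (use t elim in auto)
    then have "F v \<le> variation \<gamma> 0 (min u v)"
      using elim u by (intro chord_sum_le_variation) auto
    also have "\<dots> \<le> variation \<gamma> 0 v"
      using variation_add[of 0 "min u v" v] variation_nonneg[of "min u v" v] elim u by auto
    finally show ?case using elim by simp
  qed
qed

text \<open>Mirror image of the previous argument, with \<open>max\<close> in place of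
  \<open>min\<close>.\<close>

lemma eventually_less_variation_right:
  assumes c: "continuous_on {0..1} \<gamma>" and u: "u \<in> {0..1}" and K: "K < variation \<gamma> u 1"
  shows "\<forall>\<^sub>F v in at u within {0..1}. K < variation \<gamma> v 1"
proof -
  obtain s where s: "s \<in> chord_sums \<gamma> u 1" "K < s"
    using K less_cSup_iff[OF _ bdd_above_chord_sums[of u 1]] chord_sums_single[of u 1 \<gamma>] u
    unfolding variation_def by auto
  obtain m t where t: "s = (\<Sum>i<m. norm (\<gamma> (t (Suc i)) - \<gamma> (t i)))" "t 0 = u" "t m = 1"
    "\<And>i. i < m \<Longrightarrow> t i \<le> t (Suc i)"
    using s(1) by (rule chord_sumsE) blast
  have tb: "u \<le> t i" "t i \<le> 1" if "i \<le> m" for i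
    using partition_bounds[of t u m 1 i] t(2-4) that by auto
  define F where "F v = (\<Sum>i<m. norm (\<gamma> (max (t (Suc i)) v) - \<gamma> (max (t i) v)))" for v
  have cont: "continuous_on {0..1} (\<lambda>v. \<gamma> (max (t i) v))" if "i \<le> m" for i
    by (rule continuous_on_compose2[OF c]) (use tb[OF that] in \<open>auto intro!: continuous_intros\<close>)
  have "continuous_on {0..1} F"
    unfolding F_def using cont by (intro continuous_intros) auto
  moreover have "F u = s"
    unfolding F_def t(1) using tb by (intro sum.cong) (auto simp: max_absorb1 Suc_le_eq)
  ultimately have "(F \<longlongrightarrow> s) (at u within {0..1})"
    using u by (auto simp: continuous_on_def)
  then have "\<forall>\<^sub>F v in at u within {0..1}. K < F v"
    using s(2) order_tendstoD(1) by blast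
  moreover have "\<forall>\<^sub>F v in at u within {0..1}. v \<in> {0..1}"
    by (simp add: eventually_at_filter)
  ultimately show ?thesis
  proof eventually_elim
    case (elim v)
    have "F v \<in> chord_sums \<gamma> (max u v) 1"
      unfolding F_def
    proof (rule chord_sumsI)
      show "max (t i) v \<le> max (t (Suc i)) v" if "i < m" for i
        using t(4)[OF that] by auto
    qed (use t elim in auto)
    then have "F v \<le> variation \<gamma> (max u v) 1"
      using elim u by (intro chord_sum_le_variation) auto
    also have "\<dots> \<le> variation \<gamma> v 1"
      using variation_add[of v "max u v" 1] variation_nonneg[of v "max u v"] elim u by auto
    finally show ?case using elim by simp
  qed
qed

text \<open>Both \<open>u \<mapsto> variation \<gamma> 0 u\<close> and \<open>u \<mapsto> variation \<gamma> u 1\<close> are lower semicontinuous, as suprema of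
  continuous functions, and their sum is constant.\<close>
lemma continuous_on_arc_len:
  assumes c: "continuous_on {0..1} \<gamma>"
  shows "continuous_on {0..1} (arc_len \<gamma>)"
  unfolding continuous_on_def arc_len_eq_variation
proof (intro ballI order_tendstoI)
  fix u K :: real assume u: "u \<in> {0..1}"
  { assume "K < variation \<gamma> 0 u"
    then show "\<forall>\<^sub>F v in at u within {0..1}. K < variation \<gamma> 0 v"
      by (rule eventually_less_variation_left[OF c u]) }
  assume "variation \<gamma> 0 u < K"
  then have "variation \<gamma> 0 1 - K < variation \<gamma> u 1"
    using variation_add[of 0 u 1] u by auto
  from eventually_less_variation_right[OF c u this]
  have "\<forall>\<^sub>F v in at u within {0..1}. variation \<gamma> 0 1 - K < variation \<gamma> v 1" .
  moreover have "\<forall>\<^sub>F v in at u within {0..1}. v \<in> {0..1}"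
    by (simp add: eventually_at_filter)
  ultimately show "\<forall>\<^sub>F v in at u within {0..1}. variation \<gamma> 0 v < K"
    by eventually_elim (use variation_add[of 0 _ 1] in force)
qed

text \<open>In particular the path is constant on level sets of \<open>arc_len\<close>, so the
  preimage chosen in \<open>arc_param\<close> does not matter.\<close>

lemma norm_diff_le_arc_len_diff:
  assumes "u \<in> {0..1}" "v \<in> {0..1}"
  shows "norm (\<gamma> v - \<gamma> u) \<le> \<bar>arc_len \<gamma> v - arc_len \<gamma> u\<bar>"
proof (cases "u \<le> v")
  case True
  then show ?thesis
    using assms variation_ge_norm[of u v] variation_add[of 0 u v] by (simp add: arc_len_eq_variation)
next
  case False
  then show ?thesis
    using assms variation_ge_norm[of v u] variation_add[of 0 v u]
    by (simp add: arc_len_eq_variation norm_minus_commute)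
qed

end

lemma arc_len_0: "arc_len \<gamma> 0 = 0"
proof -
  have "c = 0" if c: "c \<in> chord_sums \<gamma> 0 0" for c
  proof -
    obtain m and t :: "nat \<Rightarrow> real"
      where t: "c = (\<Sum>i<m. norm (\<gamma> (t (Suc i)) - \<gamma> (t i)))" "t 0 = 0" "t m = 0"
      "\<And>i. i < m \<Longrightarrow> t i \<le> t (Suc i)"
      using c by (rule chord_sumsE) blast
    have "t i = 0" if "i \<le> m" for i
      using partition_bounds[of t 0 m 0 i] t(2-4) that by force
    then show ?thesis using t(1) by simp
  qed
  then have "chord_sums \<gamma> 0 0 = {0}"
    using chord_sums_single[of 0 0 \<gamma>] by fastforce
  then show ?thesis by (simp add: arc_len_def)
qed

text \<open>The intermediate value theorem makes every number up to the total length an arc length,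
  so \<open>inv_into\<close> returns a genuine preimage; the rest follows from the previous
  estimate.\<close>

lemma
  assumes "rectifiable_path \<gamma>"
  shows arc_len_nonneg: "0 \<le> arc_len \<gamma> 1"
    and arc_param_0: "arc_param \<gamma> 0 = pathstart \<gamma>"
    and arc_param_arc_len: "arc_param \<gamma> (arc_len \<gamma> 1) = pathfinish \<gamma>"
    and arc_param_in_path_image: "s \<in> {0..arc_len \<gamma> 1} \<Longrightarrow> arc_param \<gamma> s \<in> path_image \<gamma>"
    and norm_arc_param_le: "\<lbrakk>s \<in> {0..arc_len \<gamma> 1}; r \<in> {0..arc_len \<gamma> 1}\<rbrakk>
      \<Longrightarrow> norm (arc_param \<gamma> s - arc_param \<gamma> r) \<le> \<bar>s - r\<bar>"
proof -
  have c: "continuous_on {0..1} \<gamma>" and bdd: "bdd_above (chord_sums \<gamma> 0 1)"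
    using assms by (auto simp: rectifiable_path_def path_def)
  show nn: "0 \<le> arc_len \<gamma> 1"
    using variation_nonneg[OF bdd] by (simp add: arc_len_eq_variation)
  have ex: "\<exists>u\<in>{0..1}. arc_len \<gamma> u = s" if "s \<in> {0..arc_len \<gamma> 1}" for s
    using IVT'[of "arc_len \<gamma>" 0 s 1] that continuous_on_arc_len[OF bdd c] by (auto simp: arc_len_0)
  let ?i = "inv_into {0..1} (arc_len \<gamma>)"
  have i: "?i s \<in> {0..1}" "arc_len \<gamma> (?i s) = s" if "s \<in> {0..arc_len \<gamma> 1}" for s
    using ex[OF that] by (metis image_eqI inv_into_into, metis image_eqI f_inv_into_f)
  show L: "norm (arc_param \<gamma> s - arc_param \<gamma> r) \<le> \<bar>s - r\<bar>"
    if "s \<in> {0..arc_len \<gamma> 1}" "r \<in> {0..arc_len \<gamma> 1}" for s r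
    unfolding arc_param_def using norm_diff_le_arc_len_diff[OF bdd i(1) i(1)] that i(2) by metis
  show "arc_param \<gamma> s \<in> path_image \<gamma>" if "s \<in> {0..arc_len \<gamma> 1}" for s
    unfolding arc_param_def path_image_def using i(1)[OF that] by blast
  have eq: "arc_param \<gamma> (arc_len \<gamma> u) = \<gamma> u" if "u \<in> {0..1}" "arc_len \<gamma> u \<in> {0..arc_len \<gamma> 1}" for u
    using norm_diff_le_arc_len_diff[OF bdd that(1) i(1)[OF that(2)]] i(2)[OF that(2)]
    by (simp add: arc_param_def)
  show "arc_param \<gamma> 0 = pathstart \<gamma>" "arc_param \<gamma> (arc_len \<gamma> 1) = pathfinish \<gamma>"
    using eq[of 0] eq[of 1] nn by (auto simp: arc_len_0 pathstart_def pathfinish_def)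
qed

section \<open>Distance to the boundary\<close>

text \<open>The segment from \<open>z\<close> to a nearest point of the complement meets the
  frontier, and the frontier of an open set lies in the complement. Unlike the frontier, the
  complement is easy to compute after points are removed.\<close>

lemma bdist_eq_infdist_Compl:
  assumes "open G" "G \<noteq> UNIV" "z \<in> G"
  shows "bdist G z = infdist z (- G)"
proof (rule antisym)
  have ne: "- G \<noteq> {}" "closed (- G)" using assms by auto
  obtain p where p: "p \<in> - G" "infdist z (- G) = dist z p"
    using infdist_attains_inf[OF ne(2) ne(1), of z] by metis
  have "closed_segment z p \<inter> frontier G \<noteq> {}"
    by (rule connected_Int_frontier) (use assms p in auto)
  then obtain w where w: "w \<in> closed_segment z p" "w \<in> frontier G" by blast
  have "bdist G z \<le> dist z w"
    unfolding bdist_def using w(2) by (rule infdist_le)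
  also have "\<dots> \<le> dist z p"
    using dist_in_closed_segment[OF w(1)] by (simp add: dist_commute)
  finally show "bdist G z \<le> infdist z (- G)" using p by simp
  have "frontier G \<subseteq> - G" using assms(1) by (simp add: frontier_def interior_open Diff_subset_conv)
  then show "infdist z (- G) \<le> bdist G z"
    unfolding bdist_def using w(2) by (intro infdist_mono) auto
qed

lemma bdist_pos:
  assumes "open G" "G \<noteq> UNIV" "z \<in> G"
  shows "0 < bdist G z"
  unfolding bdist_eq_infdist_Compl[OF assms]
  by (rule infdist_pos_not_in_closed) (use assms in auto)

lemma bdist_le_bdist_add: "bdist G z \<le> bdist G w + norm (z - w)"
  unfolding bdist_def using infdist_triangle[of z "frontier G" w] by (simp add: dist_norm)

lemma bdist_nonneg: "0 \<le> bdist G z"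
  by (simp add: bdist_def infdist_nonneg)

lemma in_if_norm_less_bdist:
  assumes "open G" "G \<noteq> UNIV" "z \<in> G" "norm (w - z) < bdist G z"
  shows "w \<in> G"
proof (rule ccontr)
  assume "w \<notin> G"
  then have "infdist z (- G) \<le> dist z w" by (intro infdist_le) auto
  then show False using assms bdist_eq_infdist_Compl[of G z] by (simp add: dist_norm norm_minus_commute)
qed

lemma continuous_on_inverse_bdist:
  assumes "open G" "G \<noteq> UNIV" "continuous_on S h" "h ` S \<subseteq> G"
  shows "continuous_on S (\<lambda>s. 1 / bdist G (h s))"
proof -
  have "continuous_on S (\<lambda>s. bdist G (h s))"
    unfolding bdist_def using assms by (intro continuous_intros)
  then show ?thesis
    using assms bdist_pos[of G] by (intro continuous_intros) (auto, force)
qed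

lemma norm_diff_le_of_mem_closed_segment:
  fixes w y z :: "'a::euclidean_space"
  assumes "w \<in> closed_segment y z"
  shows "norm (w - y) \<le> norm (z - y)" "norm (w - z) \<le> norm (z - y)"
  using dist_in_closed_segment[OF assms] by (auto simp: dist_norm norm_minus_commute)

subsection \<open>Polygonal upper bounds for the quasihyperbolic distance\<close>

text \<open>An edge on which \<open>bdist\<close> is at least \<open>r\<close> has quasihyperbolic
  length at most its length over \<open>r\<close>, so \<open>c\<close> bounds the quasihyperbolic
  length of some polygonal path. The inequalities in both rules build in monotonicity in
  \<open>c\<close>.\<close>

inductive polygonal_cost :: "'a::euclidean_space set \<Rightarrow> 'a \<Rightarrow> 'a \<Rightarrow> real \<Rightarrow> bool" for G where
  refl: "\<lbrakk>x \<in> G; 0 \<le> c\<rbrakk> \<Longrightarrow> polygonal_cost G x x c"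
| step: "\<lbrakk>polygonal_cost G x y c; closed_segment y z \<subseteq> G; 0 < r;
    \<And>w. w \<in> closed_segment y z \<Longrightarrow> r \<le> bdist G w; c + norm (z - y) / r \<le> c'\<rbrakk>
    \<Longrightarrow> polygonal_cost G x z c'"

lemma polygonal_cost_mono:
  assumes "polygonal_cost G x y c" "c \<le> c'"
  shows "polygonal_cost G x y c'"
  using assms by (cases rule: polygonal_cost.cases) (auto intro: polygonal_cost.intros)

text \<open>Paths grow at their end point, so the induction runs over the second leg, which
  therefore is the first premise.\<close>

lemma polygonal_cost_trans:
  assumes "polygonal_cost G y z c'" "polygonal_cost G x y c"
  shows "polygonal_cost G x z (c + c')"
  using assms
proof (induction rule: polygonal_cost.induct)
  case (refl x c)
  then show ?case using polygonal_cost_mono by fastforce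
next
  case (step y w c z r c')
  show ?case
    by (rule polygonal_cost.step[OF step.IH[OF step.prems] step.hyps(2,3)]) (use step in auto)
qed

lemma polygonal_cost_segment:
  assumes "closed_segment y z \<subseteq> G" "0 < r" "\<And>w. w \<in> closed_segment y z \<Longrightarrow> r \<le> bdist G w"
    "norm (z - y) / r \<le> c"
  shows "polygonal_cost G y z c"
  by (rule polygonal_cost.step[OF polygonal_cost.refl[of y G 0] assms(1,2,3)]) (use assms in auto)

section \<open>Realizing polygonal paths by curves parametrized by arc length\<close>

text \<open>A polygonal curve attains its length as a chord sum. Together with the Lipschitz bound,
  membership of \<open>u\<close> in the chord sums says that the length up to \<open>u\<close> is
  exactly \<open>u\<close>.\<close>

definition unit_speed :: "(real \<Rightarrow> 'a::euclidean_space) \<Rightarrow> real \<Rightarrow> bool" where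
  "unit_speed h L \<longleftrightarrow> 0 \<le> L \<and> (\<forall>a\<in>{0..L}. \<forall>b\<in>{0..L}. norm (h b - h a) \<le> \<bar>b - a\<bar>) \<and>
     (\<forall>u\<in>{0..L}. u \<in> chord_sums h 0 u)"

lemma chord_sums_cong:
  assumes "c \<in> chord_sums h a b" "\<And>s. s \<in> {a..b} \<Longrightarrow> h' s = h s"
  shows "c \<in> chord_sums h' a b"
proof -
  obtain m t where t: "c = (\<Sum>i<m. norm (h (t (Suc i)) - h (t i)))" "t 0 = a" "t m = b"
    "\<And>i. i < m \<Longrightarrow> t i \<le> t (Suc i)"
    using assms(1) by (rule chord_sumsE) blast
  have "t i \<in> {a..b}" if "i \<le> m" for i
    using partition_bounds[of t a m b i] t that by auto
  then have "c = (\<Sum>i<m. norm (h' (t (Suc i)) - h' (t i)))"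
    unfolding t(1) using assms(2) by (intro sum.cong) auto
  then show ?thesis using chord_sumsI[of t a m b h'] t by metis
qed

lemma unit_speed_append_segment:
  assumes h: "unit_speed h L" and v: "norm v = 1" and l: "0 \<le> l"
  defines "h' \<equiv> \<lambda>s. if s \<le> L then h s else h L + (s - L) *\<^sub>R v"
  shows "unit_speed h' (L + l)"
proof -
  have L: "0 \<le> L" "\<And>a b. a \<in> {0..L} \<Longrightarrow> b \<in> {0..L} \<Longrightarrow> norm (h b - h a) \<le> \<bar>b - a\<bar>"
    "\<And>u. u \<in> {0..L} \<Longrightarrow> u \<in> chord_sums h 0 u"
    using h by (auto simp: unit_speed_def)
  have lip: "norm (h' b - h' a) \<le> b - a" if "0 \<le> a" "a \<le> b" for a b
  proof -
    consider "b \<le> L" | "a \<le> L" "L < b" | "L < a" using that by linarith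
    then show ?thesis
    proof cases
      case 1 then show ?thesis using L(2)[of a b] that by (simp add: h'_def)
    next
      case 2
      have "norm (h' b - h' a) = norm ((h L - h a) + (b - L) *\<^sub>R v)"
        using 2 by (simp add: h'_def algebra_simps)
      also have "\<dots> \<le> norm (h L - h a) + norm ((b - L) *\<^sub>R v)" by (rule norm_triangle_ineq)
      also have "\<dots> \<le> (L - a) + (b - L)" using L(2)[of a L] 2 that v by simp
      finally show ?thesis by simp
    next
      case 3
      have "h' b - h' a = (b - a) *\<^sub>R v" using 3 that by (simp add: h'_def algebra_simps)
      then show ?thesis using v that by simp
    qed
  qed
  have "norm (h' b - h' a) \<le> \<bar>b - a\<bar>" if "a \<in> {0..L + l}" "b \<in> {0..L + l}" for a b
    using lip[of a b] lip[of b a] that by (cases "a \<le> b") (auto simp: norm_minus_commute)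
  moreover have "u \<in> chord_sums h' 0 u" if u: "u \<in> {0..L + l}" for u
  proof (cases "u \<le> L")
    case True
    show ?thesis by (rule chord_sums_cong[OF L(3)]) (use u True in \<open>auto simp: h'_def\<close>)
  next
    case False
    have "L \<in> chord_sums h' 0 L"
      by (rule chord_sums_cong[OF L(3)]) (use L in \<open>auto simp: h'_def\<close>)
    moreover have "norm (h' u - h' L) \<in> chord_sums h' L u"
      using False by (intro chord_sums_single) auto
    ultimately have "L + norm (h' u - h' L) \<in> chord_sums h' 0 u" by (rule chord_sums_concat)
    moreover have "norm (h' u - h' L) = u - L" using False v by (simp add: h'_def)
    ultimately show ?thesis by simp
  qed
  ultimately show ?thesis using L(1) l by (auto simp: unit_speed_def)
qed

lemma unit_speed_continuous_on:
  assumes "unit_speed h L"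
  shows "continuous_on {0..L} h"
proof -
  have "dist (h b) (h a) \<le> 1 * dist b a" if "a \<in> {0..L}" "b \<in> {0..L}" for a b
    using assms that by (auto simp: unit_speed_def dist_norm)
  then have "1-lipschitz_on {0..L} h" by (auto simp: lipschitz_on_def)
  then show ?thesis by (rule lipschitz_on_continuous_on)
qed

text \<open>Each edge is appended at unit speed; its contribution to the integral is at most its
  length times \<open>1 / r\<close>.\<close>

lemma polygonal_cost_unit_speed:
  assumes "polygonal_cost G x y c" "open G" "G \<noteq> UNIV"
  shows "\<exists>h L I. unit_speed h L \<and> h 0 = x \<and> h L = y \<and> h ` {0..L} \<subseteq> G \<and>
    ((\<lambda>s. 1 / bdist G (h s)) has_integral I) {0..L} \<and> I \<le> c"
  using assms
proof (induction rule: polygonal_cost.induct)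
  case (refl x c)
  have "unit_speed (\<lambda>_. x) 0"
    using chord_sums_single[of 0 0 "\<lambda>_. x"] by (simp add: unit_speed_def)
  moreover have "((\<lambda>s. 1 / bdist G x) has_integral 0) {0..0::real}"
    using has_integral_refl(1)[of _ "0::real"] by simp
  ultimately show ?case using refl by (intro exI[of _ "\<lambda>_. x"] exI[of _ "0::real"]) auto
next
  case (step x y c z r c')
  then obtain h L I where h: "unit_speed h L" "h 0 = x" "h L = y" "h ` {0..L} \<subseteq> G"
    "((\<lambda>s. 1 / bdist G (h s)) has_integral I) {0..L}" "I \<le> c"
    by blast
  have L: "0 \<le> L" using h(1) by (simp add: unit_speed_def)
  show ?case
  proof (cases "y = z")
    \<comment> \<open>A degenerate edge has no direction vector; the curve built so far already
      serves.\<close>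
    case True
    then have "I \<le> c'" using h(6) step.hyps(5) by simp
    then show ?thesis using h(1-5) True by blast
  next
    case False
    define l where "l = norm (z - y)"
    define v where "v = (z - y) /\<^sub>R l"
    define h' where "h' s = (if s \<le> L then h s else h L + (s - L) *\<^sub>R v)" for s
    have l: "0 < l" "norm v = 1" using False by (auto simp: l_def v_def)
    have us: "unit_speed h' (L + l)"
      unfolding h'_def using unit_speed_append_segment[OF h(1) l(2)] l(1) by simp
    have eq: "h' s = y + ((s - L) / l) *\<^sub>R (z - y)" if "L \<le> s" for s
      using that h(3) l(1) by (auto simp: h'_def v_def divide_inverse)
    have seg: "h' s \<in> closed_segment y z" if "s \<in> {L..L + l}" for s
      unfolding closed_segment_def using that l
      by (intro CollectI exI[of _ "(s - L) / l"]) (auto simp: eq algebra_simps)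
    have im: "h' ` {0..L + l} \<subseteq> G"
    proof safe
      fix s assume "s \<in> {0..L + l}"
      then show "h' s \<in> G"
        using h(4) seg[of s] step.hyps(2) by (cases "s \<le> L") (auto simp: h'_def)
    qed
    have i1: "((\<lambda>s. 1 / bdist G (h' s)) has_integral I) {0..L}"
      by (rule has_integral_eq[OF _ h(5)]) (simp add: h'_def)
    have "continuous_on {L..L + l} (\<lambda>s. 1 / bdist G (h' s))"
      using continuous_on_inverse_bdist[OF step.prems unit_speed_continuous_on[OF us] im]
      by (rule continuous_on_subset) (use L in auto)
    then obtain J where J: "((\<lambda>s. 1 / bdist G (h' s)) has_integral J) {L..L + l}"
      using integrable_continuous_real by blast
    have "1 / bdist G (h' s) \<le> 1 / r" if "s \<in> {L..L + l}" for s
      using step.hyps(3) step.hyps(4)[OF seg[OF that]] by (intro divide_left_mono) auto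
    moreover have "((\<lambda>s. 1 / r) has_integral l * (1 / r)) {L..L + l}"
      using has_integral_const_real[of "1 / r" L "L + l"] l by simp
    ultimately have "J \<le> l / r"
      using has_integral_le[OF J] by simp
    moreover have "((\<lambda>s. 1 / bdist G (h' s)) has_integral (I + J)) {0..L + l}"
      using L l by (intro has_integral_combine[OF _ _ i1 J]) auto
    moreover have "h' 0 = x" "h' (L + l) = z"
      using h(2) L l eq[of "L + l"] by (auto simp: h'_def)
    moreover have "I + J \<le> c'"
      using calculation h(6) step.hyps(5) by (simp add: l_def)
    ultimately show ?thesis using us im by blast
  qed
qed

text \<open>After rescaling to the unit interval, \<open>u * L\<close> is the maximum of the chord
  sums: partitions are divided by \<open>L\<close>, and the Lipschitz bound telescopes. For
  \<open>L = 0\<close> a single chord does.\<close>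

lemma unit_speed_arc_len:
  assumes h: "unit_speed h L" and u: "u \<in> {0..1}"
  defines "\<gamma> \<equiv> \<lambda>t. h (t * L)"
  shows "u * L \<in> chord_sums \<gamma> 0 u" "\<And>c. c \<in> chord_sums \<gamma> 0 u \<Longrightarrow> c \<le> u * L"
proof -
  have L: "0 \<le> L" "\<And>a b. a \<in> {0..L} \<Longrightarrow> b \<in> {0..L} \<Longrightarrow> norm (h b - h a) \<le> \<bar>b - a\<bar>"
    "\<And>u. u \<in> {0..L} \<Longrightarrow> u \<in> chord_sums h 0 u"
    using h by (auto simp: unit_speed_def)
  have mem: "s * L \<in> {0..L}" if "s \<in> {0..1}" for s
    using that L(1) by (auto simp: mult_left_le_one_le)
  show "u * L \<in> chord_sums \<gamma> 0 u"
  proof (cases "L = 0")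
    case True
    then show ?thesis using chord_sums_single[of 0 u \<gamma>] u by (simp add: \<gamma>_def)
  next
    case False
    obtain m t where t: "u * L = (\<Sum>i<m. norm (h (t (Suc i)) - h (t i)))" "t 0 = 0" "t m = u * L"
      "\<And>i. i < m \<Longrightarrow> t i \<le> t (Suc i)"
      using L(3)[OF mem[OF u]] by (rule chord_sumsE) blast
    have "(\<Sum>i<m. norm (\<gamma> (t (Suc i) / L) - \<gamma> (t i / L))) \<in> chord_sums \<gamma> 0 u"
      using t(2-4) False L(1) by (intro chord_sumsI) (auto intro: divide_right_mono)
    then show ?thesis using False t(1) by (simp add: \<gamma>_def)
  qed
  show "c \<le> u * L" if c: "c \<in> chord_sums \<gamma> 0 u" for c
  proof -
    obtain m t where t: "c = (\<Sum>i<m. norm (\<gamma> (t (Suc i)) - \<gamma> (t i)))" "t 0 = 0" "t m = u"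
      "\<And>i. i < m \<Longrightarrow> t i \<le> t (Suc i)"
      using c by (rule chord_sumsE) blast
    have tb: "t i \<in> {0..1}" if "i \<le> m" for i
      using partition_bounds[of t 0 m u i] t that u by auto
    have "norm (\<gamma> (t (Suc i)) - \<gamma> (t i)) \<le> t (Suc i) * L - t i * L" if "i < m" for i
      using L(2)[OF mem[OF tb[of i]] mem[OF tb[of "Suc i"]]] that
        mult_right_mono[OF t(4)[OF that] L(1)] by (simp add: \<gamma>_def)
    then have "c \<le> (\<Sum>i<m. t (Suc i) * L - t i * L)" unfolding t(1) by (intro sum_mono) auto
    also have "\<dots> = u * L" using t(2,3) sum_lessThan_telescope[of "\<lambda>i. t i * L" m] by simp
    finally show ?thesis .
  qed
qed

text \<open>Since the arc length of the rescaled path is \<open>u * L\<close>,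
  \<open>arc_param\<close> recovers \<open>h\<close> on \<open>{0..L}\<close>.\<close>

lemma unit_speed_rectifiable:
  assumes h: "unit_speed h L"
  defines "\<gamma> \<equiv> \<lambda>t. h (t * L)"
  shows "rectifiable_path \<gamma>" "arc_integral \<gamma> \<rho> = integral {0..L} (\<lambda>s. \<rho> (h s))"
    "path_image \<gamma> = h ` {0..L}"
proof -
  have L: "0 \<le> L" using h by (auto simp: unit_speed_def)
  have len: "arc_len \<gamma> u = u * L" if "u \<in> {0..1}" for u
    unfolding arc_len_def using unit_speed_arc_len[OF h that] unfolding \<gamma>_def
    by (intro cSup_eq_maximum) auto
  have "continuous_on {0..1} \<gamma>"
    unfolding \<gamma>_def using L
    by (intro continuous_on_compose2[OF unit_speed_continuous_on[OF h]] continuous_intros)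
      (auto simp: mult_left_le_one_le)
  moreover have "bdd_above (chord_sums \<gamma> 0 1)"
    using unit_speed_arc_len(2)[OF h, of 1] unfolding \<gamma>_def by (auto simp: bdd_above_def)
  ultimately show "rectifiable_path \<gamma>" by (simp add: rectifiable_path_def path_def)
  have im: "(\<lambda>t. t * L) ` {0..1} = {0..L}"
    using image_mult_atLeastAtMost_if[of L 0 1] L by (simp add: mult.commute[of _ L])
  show "path_image \<gamma> = h ` {0..L}"
    unfolding path_image_def \<gamma>_def im[symmetric] image_image ..
  have "arc_param \<gamma> s = h s" if "s \<in> {0..L}" for s
  proof -
    let ?u = "inv_into {0..1} (arc_len \<gamma>) s"
    have "s \<in> arc_len \<gamma> ` {0..1}" using that im len by (metis (no_types, lifting) image_cong)
    then have "?u \<in> {0..1}" "arc_len \<gamma> ?u = s"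
      by (rule inv_into_into, rule f_inv_into_f)
    then show ?thesis using len by (simp add: arc_param_def \<gamma>_def)
  qed
  then show "arc_integral \<gamma> \<rho> = integral {0..L} (\<lambda>s. \<rho> (h s))"
    unfolding arc_integral_def using len[of 1] by (auto intro!: integral_cong)
qed

text \<open>If the integrand is not integrable, its integral takes the default value 0, so the bound
  holds in that case as well.\<close>

lemma arc_integral_nonneg:
  assumes "\<And>z. 0 \<le> \<rho> z"
  shows "0 \<le> arc_integral \<gamma> \<rho>"
  unfolding arc_integral_def using assms
  by (metis integral_nonneg not_integrable_integral order_refl)

lemma polygonal_cost_path:
  assumes "polygonal_cost G x y c" "open G" "G \<noteq> UNIV"
  shows "\<exists>\<gamma>. rectifiable_path \<gamma> \<and> path_image \<gamma> \<subseteq> G \<and> pathstart \<gamma> = x \<and> pathfinish \<gamma> = y \<and>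
    arc_integral \<gamma> (\<lambda>z. 1 / bdist G z) \<le> c"
proof -
  obtain h L I where h: "unit_speed h L" "h 0 = x" "h L = y" "h ` {0..L} \<subseteq> G"
    "((\<lambda>s. 1 / bdist G (h s)) has_integral I) {0..L}" "I \<le> c"
    using polygonal_cost_unit_speed[OF assms] by blast
  show ?thesis
    using unit_speed_rectifiable[OF h(1)] h(2-4,6) integral_unique[OF h(5)]
    by (intro exI[of _ "\<lambda>t. h (t * L)"]) (auto simp: pathstart_def pathfinish_def)
qed

lemma qh_dist_le_polygonal_cost:
  assumes "polygonal_cost G x y c" "open G" "G \<noteq> UNIV"
  shows "qh_dist G x y \<le> c"
proof -
  obtain \<gamma> where \<gamma>: "rectifiable_path \<gamma>" "path_image \<gamma> \<subseteq> G" "pathstart \<gamma> = x" "pathfinish \<gamma> = y"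
    "arc_integral \<gamma> (\<lambda>z. 1 / bdist G z) \<le> c"
    using polygonal_cost_path[OF assms] by blast
  have "bdd_below {arc_integral \<gamma> (\<lambda>z. 1 / bdist G z) | \<gamma>.
      rectifiable_path \<gamma> \<and> path_image \<gamma> \<subseteq> G \<and> pathstart \<gamma> = x \<and> pathfinish \<gamma> = y}"
    by (rule bdd_belowI[of _ 0]) (auto intro!: arc_integral_nonneg simp: bdist_nonneg)
  then have "qh_dist G x y \<le> arc_integral \<gamma> (\<lambda>z. 1 / bdist G z)"
    unfolding qh_dist_def using \<gamma> by (intro cInf_lower) auto
  then show ?thesis using \<gamma>(5) by simp
qed

text \<open>Within \<open>bdist G x / 2\<close> of \<open>x\<close> the boundary distance is at
  least half of \<open>bdist G x\<close>; this loss is the factor 2.\<close>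

lemma polygonal_cost_near:
  assumes "open G" "G \<noteq> UNIV" "x \<in> G" "norm (y - x) \<le> bdist G x / 2"
  shows "polygonal_cost G x y (2 * norm (y - x) / bdist G x)"
proof (rule polygonal_cost_segment[where r = "bdist G x / 2"])
  have pos: "0 < bdist G x" by (rule bdist_pos) fact+
  then show "0 < bdist G x / 2" by simp
  have w: "norm (w - x) \<le> bdist G x / 2" if "w \<in> closed_segment x y" for w
    using norm_diff_le_of_mem_closed_segment[OF that] assms(4) by simp
  show "closed_segment x y \<subseteq> G"
    using w pos in_if_norm_less_bdist[OF assms(1-3)] by fastforce
  show "bdist G x / 2 \<le> bdist G w" if "w \<in> closed_segment x y" for w
    using w[OF that] bdist_le_bdist_add[of G x w] by (simp add: norm_minus_commute)
qed (simp add: mult.commute)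

text \<open>Guarantees that the infimum in \<open>qh_dist\<close> is taken over a non-empty
  set.\<close>

lemma polygonal_cost_exists:
  assumes "open G" "connected G" "G \<noteq> UNIV" "x \<in> G" "y \<in> G"
  shows "\<exists>c. polygonal_cost G x y c"
proof (rule connected_induction_simple[OF assms(2,4,5)])
  show "\<exists>c. polygonal_cost G x x c" using assms polygonal_cost.refl by blast
  fix a assume a: "a \<in> G"
  \<comment> \<open>The radius is a quarter because the path from \<open>u\<close> back to
    \<open>a\<close> is measured at \<open>u\<close>, where \<open>bdist\<close> is still at least
    three quarters of \<open>bdist G a\<close>.\<close>
  define T where "T = ball a (bdist G a / 4)"
  have pos: "0 < bdist G a" by (rule bdist_pos) fact+
  have TG: "T \<subseteq> G"
    unfolding T_def using in_if_norm_less_bdist[OF assms(1,3) a] pos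
    by (auto simp: dist_norm norm_minus_commute)
  show "\<exists>T. openin (top_of_set G) T \<and> a \<in> T \<and>
    (\<forall>u\<in>T. \<forall>v\<in>T. (\<exists>c. polygonal_cost G x u c) \<longrightarrow> (\<exists>c. polygonal_cost G x v c))"
  proof (intro exI[of _ T] conjI ballI impI)
    show "openin (top_of_set G) T" using TG by (simp add: T_def open_subset)
    show "a \<in> T" using pos by (simp add: T_def)
    fix u v assume u: "u \<in> T" and v: "v \<in> T" and "\<exists>c. polygonal_cost G x u c"
    then obtain c where c: "polygonal_cost G x u c" by blast
    have near: "norm (a - u) < bdist G a / 4" "norm (a - v) < bdist G a / 4"
      using u v by (auto simp: T_def dist_norm)
    have ua: "norm (a - u) \<le> bdist G u / 2"
      using near bdist_le_bdist_add[of G a u] norm_ge_zero[of "a - u"] by linarith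
    have "polygonal_cost G x a (c + 2 * norm (a - u) / bdist G u)"
      using polygonal_cost_trans[OF polygonal_cost_near[OF assms(1,3) _ ua] c] u TG by auto
    moreover have "norm (v - a) \<le> bdist G a / 2"
      using near pos by (simp add: norm_minus_commute)
    ultimately show "\<exists>c. polygonal_cost G x v c"
      using polygonal_cost_trans[OF polygonal_cost_near[OF assms(1,3) a]] by blast
  qed
qed

subsection \<open>Chains of points from a bound on the quasihyperbolic distance\<close>

text \<open>Asymmetric: the step is compared with the boundary distance at its first point. Powers
  of this relation are chains.\<close>

definition near_pairs :: "'a::euclidean_space set \<Rightarrow> ('a \<times> 'a) set" where
  "near_pairs D = {(z, w). z \<in> D \<and> w \<in> D \<and> norm (w - z) \<le> bdist D z / 4}"

text \<open>Walk along the curve, advancing the parameter by a quarter of the current boundary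
  distance. Every advance that stops short of the end uses up at least \<open>1 / 5\<close> of the
  integral.\<close>

lemma lipschitz_curve_chain:
  assumes D: "open D" "D \<noteq> UNIV" and im: "g ` {0..l} \<subseteq> D"
    and lip: "\<And>s r. \<lbrakk>s \<in> {0..l}; r \<in> {0..l}\<rbrakk> \<Longrightarrow> norm (g s - g r) \<le> \<bar>s - r\<bar>"
    and a: "a \<in> {0..l}" and int: "integral {a..l} (\<lambda>s. 1 / bdist D (g s)) < (real N + 1) / 5"
  shows "\<exists>k \<le> N + 1. (g a, g l) \<in> near_pairs D ^^ k"
  using a int
proof (induction N arbitrary: a)
  let ?f = "\<lambda>s. 1 / bdist D (g s)"
  have "1-lipschitz_on {0..l} g" using lip by (auto simp: lipschitz_on_def dist_norm)
  then have "continuous_on {0..l} g" by (rule lipschitz_on_continuous_on)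
  then have "continuous_on {0..l} ?f" by (rule continuous_on_inverse_bdist[OF D _ im])
  then have int: "?f integrable_on {u..v}" if "0 \<le> u" "v \<le> l" for u v
    using that by (intro integrable_continuous_real) (auto elim: continuous_on_subset)
  have key: "(g a, g l) \<in> near_pairs D \<or>
      (\<exists>b\<in>{a..l}. (g a, g b) \<in> near_pairs D \<and> integral {b..l} ?f + 1 / 5 \<le> integral {a..l} ?f)"
    if a: "a \<in> {0..l}" for a
  proof -
    let ?r = "bdist D (g a)"
    have ga: "g a \<in> D" using im a by auto
    have r: "0 < ?r" by (rule bdist_pos[OF D ga])
    show ?thesis
    proof (cases "l \<le> a + ?r / 4")
      case True
      then have "(g a, g l) \<in> near_pairs D"
        using lip[of l a] a im by (auto simp: near_pairs_def)
      then show ?thesis ..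
    next
      case False
      let ?b = "a + ?r / 4"
      have b: "?b \<in> {a..l}" "?b \<in> {0..l}" using False r a by auto
      have "(g a, g ?b) \<in> near_pairs D"
        using lip[of ?b a] a b r im by (auto simp: near_pairs_def)
      moreover have "1 / 5 \<le> integral {a..?b} ?f"
      proof -
        \<comment> \<open>On this piece \<open>bdist\<close> is at most \<open>5 / 4 * ?r\<close>;
          the interval has length \<open>?r / 4\<close>, hence the bound
          \<open>1 / 5\<close>.\<close>
        have "integral {a..?b} (\<lambda>_. 4 / (5 * ?r)) \<le> integral {a..?b} ?f"
        proof (rule integral_le)
          show "?f integrable_on {a..?b}" using a b by (intro int) auto
          fix s assume s: "s \<in> {a..?b}"
          then have "norm (g s - g a) \<le> ?r / 4" using lip[of s a] a b by auto
          then have "bdist D (g s) \<le> 5 * ?r / 4" using bdist_le_bdist_add[of D "g s" "g a"] by simp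
          moreover have "0 < bdist D (g s)" by (rule bdist_pos[OF D]) (use s a b im in auto)
          ultimately show "4 / (5 * ?r) \<le> ?f s" using r by (simp add: field_simps)
        qed (rule integrable_const_ivl)
        then show ?thesis using r by simp
      qed
      moreover have "integral {a..?b} ?f + integral {?b..l} ?f = integral {a..l} ?f"
        using a b by (intro Henstock_Kurzweil_Integration.integral_combine int) auto
      ultimately show ?thesis using b by (intro disjI2 bexI[of _ ?b]) auto
    qed
  qed
  {
    case 0
    \<comment> \<open>With less than \<open>1 / 5\<close> left, an advance that stops short would
      leave a negative integral.\<close>
    have "0 \<le> integral {b..l} ?f" if "b \<in> {a..l}" for b
      using that 0 by (intro integral_nonneg int) (auto simp: bdist_nonneg)
    then have "(g a, g l) \<in> near_pairs D" using key[OF 0(1)] 0(2) by force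
    then show ?case by (intro exI[of _ 1]) auto
  next
    case (Suc N)
    from key[OF Suc.prems(1)] show ?case
    proof
      assume "(g a, g l) \<in> near_pairs D"
      then show ?thesis by (intro exI[of _ 1]) auto
    next
      assume "\<exists>b\<in>{a..l}. (g a, g b) \<in> near_pairs D \<and> integral {b..l} ?f + 1 / 5 \<le> integral {a..l} ?f"
      then obtain b where b: "b \<in> {a..l}" "(g a, g b) \<in> near_pairs D"
        "integral {b..l} ?f + 1 / 5 \<le> integral {a..l} ?f" by blast
      have "integral {b..l} ?f < (real N + 1) / 5" using b(3) Suc.prems(2) by (simp add: field_simps)
      with Suc.IH[of b] b(1) Suc.prems(1) obtain k
        where "k \<le> N + 1" "(g b, g l) \<in> near_pairs D ^^ k" by auto
      then show ?thesis using relpow_Suc_I2[OF b(2)] by (intro exI[of _ "Suc k"]) auto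
    qed
  }
qed

text \<open>The infimum need not be attained, so a path of cost below \<open>M + 1\<close> is used.
  It gives at most \<open>N + 1\<close> steps, where \<open>N\<close> is \<open>5 * (M + 1)\<close>
  rounded up.\<close>

lemma qh_dist_chain:
  assumes D: "is_domain D" "D \<noteq> UNIV" and xy: "x \<in> D" "y \<in> D" and M: "qh_dist D x y \<le> M"
  shows "\<exists>k. real k \<le> 5 * M + 7 \<and> (x, y) \<in> near_pairs D ^^ k"
proof -
  have op: "open D" "connected D" using D by (auto simp: is_domain_def)
  obtain c where "polygonal_cost D x y c" using polygonal_cost_exists[OF op D(2) xy] by blast
  then have "\<exists>\<gamma>. rectifiable_path \<gamma> \<and> path_image \<gamma> \<subseteq> D \<and> pathstart \<gamma> = x \<and> pathfinish \<gamma> = y"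
    using polygonal_cost_path[OF _ op(1) D(2)] by blast
  then have "\<exists>v\<in>{arc_integral \<gamma> (\<lambda>z. 1 / bdist D z) | \<gamma>.
      rectifiable_path \<gamma> \<and> path_image \<gamma> \<subseteq> D \<and> pathstart \<gamma> = x \<and> pathfinish \<gamma> = y}. v < M + 1"
    using M unfolding qh_dist_def by (intro cInf_lessD) auto
  then obtain \<gamma> where \<gamma>: "rectifiable_path \<gamma>" "path_image \<gamma> \<subseteq> D" "pathstart \<gamma> = x" "pathfinish \<gamma> = y"
    and less: "arc_integral \<gamma> (\<lambda>z. 1 / bdist D z) < M + 1" by blast
  let ?g = "arc_param \<gamma>" and ?l = "arc_len \<gamma> 1"
  define N where "N = nat \<lceil>5 * (M + 1)\<rceil>"
  \<comment> \<open>Ensures that \<open>nat\<close> does not truncate in \<open>N\<close>.\<close>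
  have "0 \<le> M + 1"
    using less arc_integral_nonneg[of "\<lambda>z. 1 / bdist D z" \<gamma>] by (simp add: bdist_nonneg)
  then have N: "5 * (M + 1) \<le> real N" "real N \<le> 5 * (M + 1) + 1"
    using of_nat_ceiling[of "5 * (M + 1)"] of_int_ceiling_le_add_one[of "5 * (M + 1)"]
    by (simp_all add: N_def del: ceiling_add_numeral ceiling_diff_numeral ring_distribs)
  have "\<exists>k \<le> N + 1. (?g 0, ?g ?l) \<in> near_pairs D ^^ k"
  proof (rule lipschitz_curve_chain[OF op(1) D(2)])
    show "?g ` {0..?l} \<subseteq> D" using arc_param_in_path_image[OF \<gamma>(1)] \<gamma>(2) by blast
    show "0 \<in> {0..?l}" using arc_len_nonneg[OF \<gamma>(1)] by simp
    show "integral {0..?l} (\<lambda>s. 1 / bdist D (?g s)) < (real N + 1) / 5"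
      using less N(1) by (simp add: arc_integral_def)
  qed (rule norm_arc_param_le[OF \<gamma>(1)])
  then obtain k where "k \<le> N + 1" "(x, y) \<in> near_pairs D ^^ k"
    using arc_param_0[OF \<gamma>(1)] arc_param_arc_len[OF \<gamma>(1)] \<gamma>(3,4) by auto
  then show ?thesis using N(2) by (intro exI[of _ k]) auto
qed

subsection \<open>Removing a geometric sequence of points\<close>

text \<open>Below 0 and above \<open>d\<close> there is free room. In between, a number
  \<open>a\<close> exceeding \<mu> lies in a gap \<open>[c, 2 * c)\<close> of the sequence with
  \<open>c\<close> above \<open>\<mu> / 2\<close>, wide enough to be shrunk by
  \<open>\<mu> / 8\<close> at both ends. The coordinates of the removed points are among the
  \<open>d / 2 ^ k\<close>.\<close>

lemma geometric_sequence_gap: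
  fixes a d \<mu> :: real
  assumes d: "0 < d" and \<mu>: "0 < \<mu>"
  shows "\<exists>b. \<bar>b - a\<bar> \<le> 2 * \<mu> \<and> \<mu> / 8 \<le> \<bar>b\<bar> \<and> (\<forall>k::nat. \<mu> / 8 \<le> \<bar>b - d / 2 ^ k\<bar>)"
proof -
  have le: "0 < d / 2 ^ k" "d / 2 ^ k \<le> d" for k :: nat
    using d by (auto simp: divide_le_eq)
  consider "a \<le> \<mu>" | "\<mu> < a" "d \<le> a" | "\<mu> < a" "a < d" by linarith
  then show ?thesis
  proof cases
    case 1
    have "\<mu> / 8 \<le> \<bar>min a 0 - \<mu> - d / 2 ^ k\<bar>" for k using le(1)[of k] \<mu> by linarith
    then show ?thesis using 1 \<mu> by (intro exI[of _ "min a 0 - \<mu>"]) auto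
  next
    case 2
    have "\<mu> / 8 \<le> \<bar>a + \<mu> - d / 2 ^ k\<bar>" for k using le(2)[of k] 2 \<mu> by linarith
    then show ?thesis using 2 \<mu> by (intro exI[of _ "a + \<mu>"]) auto
  next
    case 3
    define P where "P n \<longleftrightarrow> d / 2 ^ n \<le> a" for n :: nat
    have "\<exists>n. d / a < 2 ^ n" by (rule real_arch_pow) simp
    then obtain n where "d / a < 2 ^ n" ..
    then have "P n" using 3 \<mu> by (simp add: P_def field_simps)
    then have PL: "P (LEAST n. P n)" by (rule LeastI)
    have "\<not> P 0" using 3 by (simp add: P_def)
    then obtain j where j: "(LEAST n. P n) = Suc j" using PL by (metis not0_implies_Suc)
    then have "\<not> P j" by (metis lessI not_less_Least)
    define c where "c = d / 2 ^ Suc j"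
    have c: "c \<le> a" "a < 2 * c"
      using PL \<open>\<not> P j\<close> j by (auto simp: P_def c_def)
    \<comment> \<open>Clamps \<open>a\<close> to the shrunken gap.\<close>
    define b where "b = max (c + \<mu> / 8) (min a (2 * c - \<mu> / 8))"
    have b: "c + \<mu> / 8 \<le> b" "b \<le> 2 * c - \<mu> / 8" "\<bar>b - a\<bar> \<le> 2 * \<mu>"
      using c 3 \<mu> by (auto simp: b_def)
    have "\<mu> / 8 \<le> \<bar>b - d / 2 ^ k\<bar>" for k
    proof (cases "k \<le> j")
      case True
      then have "d / 2 ^ j \<le> d / 2 ^ k" using d by (intro divide_left_mono) auto
      then have "2 * c \<le> d / 2 ^ k" by (simp add: c_def)
      then show ?thesis using b \<mu> by linarith
    next
      case False
      then have "(2::real) ^ Suc j \<le> 2 ^ k" by (intro power_increasing) auto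
      then have "d / 2 ^ k \<le> c" unfolding c_def using d by (intro divide_left_mono) auto
      then show ?thesis using b \<mu> by linarith
    qed
    moreover have "\<mu> / 8 \<le> \<bar>b\<bar>" using b c 3 \<mu> by linarith
    ultimately show ?thesis using b(3) by blast
  qed
qed

section \<open>The punctured domain and estimates near its centre\<close>

text \<open>The sequence is in closed form along the unit direction \<open>e\<close>; the orthogonal
  \<open>f\<close> provides a direction in which to leave its line. The first removed point is at
  distance \<open>d / 8\<close>, hence the exponent \<open>k + 3\<close>.\<close>

locale punctured_domain =
  fixes D :: "'a::euclidean_space set" and x0 e f :: 'a and d :: real and E G :: "'a set"
  assumes dom: "is_domain D" "D \<noteq> UNIV" and x0: "x0 \<in> D" and d_eq: "d = bdist D x0"
    and e: "norm e = 1" and f: "norm f = 1" and ef: "e \<bullet> f = 0"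
    and E_eq: "E = insert x0 (range (\<lambda>k. x0 + (d / 2 ^ (k + 3)) *\<^sub>R e))"
    and G_eq: "G = D - E"
begin

lemma open_D: "open D"
  using dom by (simp add: is_domain_def)

lemma d_pos: "0 < d"
  unfolding d_eq by (rule bdist_pos) (use dom x0 in \<open>auto simp: is_domain_def\<close>)

lemma E_coord:
  assumes "q \<in> E"
  obtains \<sigma> where "q = x0 + \<sigma> *\<^sub>R e" "0 \<le> \<sigma>" "\<sigma> \<le> d / 8" "\<sigma> = 0 \<or> (\<exists>k. \<sigma> = d / 2 ^ k)"
proof -
  consider "q = x0" | k where "q = x0 + (d / 2 ^ (k + 3)) *\<^sub>R e" using assms by (auto simp: E_eq)
  then show ?thesis
  proof cases
    case 1 then show ?thesis using that[of 0] d_pos by simp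
  next
    case 2
    have "d / 2 ^ (k + 3) \<le> d / 8"
      using d_pos by (intro divide_left_mono) (auto simp: power_add)
    then show ?thesis using that[OF 2] d_pos by force
  qed
qed

lemma x0_in_E: "x0 \<in> E"
  by (simp add: E_eq)

lemma norm_E_le: "q \<in> E \<Longrightarrow> norm (q - x0) \<le> d / 8"
  by (elim E_coord) (simp add: e)

lemma closed_E: "closed E"
proof -
  have "(\<lambda>k. d / 2 ^ k) \<longlonglongrightarrow> 0" by (intro LIMSEQ_divide_realpow_zero) auto
  then have "(\<lambda>k. d / 2 ^ (k + 3)) \<longlonglongrightarrow> 0" by (rule LIMSEQ_ignore_initial_segment)
  then have "(\<lambda>k. x0 + (d / 2 ^ (k + 3)) *\<^sub>R e) \<longlonglongrightarrow> x0 + 0 *\<^sub>R e"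
    by (intro tendsto_intros)
  then have "compact E" unfolding E_eq by (intro compact_sequence_with_limit) simp
  then show ?thesis by (rule compact_imp_closed)
qed

lemma open_G: "open G"
  unfolding G_eq using open_D closed_E by (rule open_Diff)

lemma G_neq_UNIV: "G \<noteq> UNIV"
  using x0_in_E by (auto simp: G_eq)

text \<open>The complement of \<open>G\<close> is the union of \<open>- D\<close> and
  \<open>E\<close>, and the distance to a union is the smaller of the two distances.\<close>

lemma bdist_G:
  assumes "z \<in> G"
  shows "bdist G z = min (bdist D z) (infdist z E)"
proof -
  have "- G = - D \<union> E" by (auto simp: G_eq)
  moreover have "- D \<noteq> {}" "E \<noteq> {}" using dom x0_in_E by auto
  ultimately have "infdist z (- G) = min (infdist z (- D)) (infdist z E)"
    by (simp add: infdist_Un_min)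
  then show ?thesis
    using bdist_eq_infdist_Compl[OF open_G G_neq_UNIV assms]
      bdist_eq_infdist_Compl[OF open_D dom(2), of z] assms by (simp add: G_eq)
qed

lemma bdist_G_ge:
  assumes "z \<in> D" "0 < r" "r \<le> bdist D z" "\<And>q. q \<in> E \<Longrightarrow> r \<le> norm (z - q)"
  shows "z \<in> G" "r \<le> bdist G z"
proof -
  show zG: "z \<in> G" using assms(1,2) assms(4)[of z] by (auto simp: G_eq)
  have "r \<le> infdist z E"
    using x0_in_E assms(4) by (subst infdist_notempty) (auto intro!: cINF_greatest simp: dist_norm)
  then show "r \<le> bdist G z" using assms(3) bdist_G[OF zG] by simp
qed

lemma bdist_G_le:
  assumes "z \<in> G"
  shows "bdist G z \<le> bdist D z" "q \<in> E \<Longrightarrow> bdist G z \<le> norm (z - q)"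
  using bdist_G[OF assms] infdist_le[of q E z] by (auto simp: dist_norm)

lemma central_ball:
  assumes "norm (z - x0) \<le> 3 * d / 4"
  shows "z \<in> D" "d / 4 \<le> bdist D z"
proof -
  show "z \<in> D" using in_if_norm_less_bdist[OF open_D dom(2) x0, of z] assms d_pos d_eq by auto
  show "d / 4 \<le> bdist D z"
    using bdist_le_bdist_add[of D x0 z] assms d_eq by (simp add: norm_minus_commute)
qed

text \<open>In the ball of radius \<open>3 * d / 4\<close> the boundary of \<open>D\<close> is at
  least \<open>d / 4\<close> away, so only the distance to \<open>E\<close> has to be
  controlled.\<close>

lemma polygonal_cost_segment_central:
  assumes "norm (y - x0) \<le> 3 * d / 4" "norm (z - x0) \<le> 3 * d / 4" "0 < \<mu>" "\<mu> \<le> d / 4"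
    and "\<And>w q. \<lbrakk>w \<in> closed_segment y z; q \<in> E\<rbrakk> \<Longrightarrow> \<mu> \<le> norm (w - q)"
  shows "polygonal_cost G y z (norm (z - y) / \<mu>)"
proof -
  have "closed_segment y z \<subseteq> cball x0 (3 * d / 4)"
    using assms(1,2) by (intro closed_segment_subset) (auto simp: dist_norm norm_minus_commute)
  then have "norm (w - x0) \<le> 3 * d / 4" if "w \<in> closed_segment y z" for w
    using that by (auto simp: dist_norm norm_minus_commute)
  then have "w \<in> G" "\<mu> \<le> bdist G w" if "w \<in> closed_segment y z" for w
    using central_ball[of w] bdist_G_ge[of w \<mu>] assms(3-5) that by force+
  then show ?thesis using assms(3) by (intro polygonal_cost_segment[of y z G \<mu>]) auto
qed

lemma inner_diff_E:
  assumes "q \<in> E" "e \<bullet> g = 0"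
  shows "(w - q) \<bullet> g = (w - x0) \<bullet> g"
  using assms(1) by (rule E_coord) (simp add: inner_diff_left inner_add_left assms(2))

text \<open>Pushing both points by \<open>\<mu>\<close> in a direction orthogonal to the line carrying \<open>E\<close>, away from that
  line, never decreases the distance to \<open>E\<close>.\<close>
lemma polygonal_cost_same_side:
  assumes g: "norm g = 1" "e \<bullet> g = 0"
    and side: "0 \<le> (x - x0) \<bullet> g" "0 \<le> (y - x0) \<bullet> g"
    and \<mu>: "0 < \<mu>" "\<mu> \<le> d / 4"
    and far: "\<And>q. q \<in> E \<Longrightarrow> \<mu> \<le> norm (x - q)" "\<And>q. q \<in> E \<Longrightarrow> \<mu> \<le> norm (y - q)"
    and R: "norm (x - x0) \<le> R" "norm (y - x0) \<le> R" "R + \<mu> \<le> 3 * d / 4"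
  shows "polygonal_cost G x y ((norm (x - y) + 2 * \<mu>) / \<mu>)"
proof -
  have near: "norm (z + \<mu> *\<^sub>R g - x0) \<le> 3 * d / 4" if "norm (z - x0) \<le> R" for z
    using norm_triangle_ineq[of "z - x0" "\<mu> *\<^sub>R g"] that R(3) g(1) \<mu> by (simp add: algebra_simps)
  have push: "\<mu> \<le> norm (w - q)"
    if z: "0 \<le> (z - x0) \<bullet> g" "\<And>q. q \<in> E \<Longrightarrow> \<mu> \<le> norm (z - q)"
      and w: "w \<in> closed_segment z (z + \<mu> *\<^sub>R g)" and q: "q \<in> E" for z w q
  proof -
    obtain u where u: "0 \<le> u" "w = (1 - u) *\<^sub>R z + u *\<^sub>R (z + \<mu> *\<^sub>R g)"
      using w by (auto simp: closed_segment_def)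
    then have w_eq: "w - q = (z - q) + (u * \<mu>) *\<^sub>R g" by (simp add: algebra_simps)
    have "0 \<le> (z - q) \<bullet> g" using inner_diff_E[OF q g(2)] z(1) by simp
    then have "(norm (z - q))\<^sup>2 \<le> (norm (w - q))\<^sup>2"
      unfolding w_eq power2_norm_eq_inner using u(1) \<mu>(1)
      by (simp add: inner_add_left inner_add_right inner_commute)
    then have "norm (z - q) \<le> norm (w - q)" by (rule power2_le_imp_le) simp
    then show ?thesis using z(2)[OF q] by simp
  qed
  \<comment> \<open>The \<open>g\<close>-coordinate is at least \<mu> along the whole segment and
    vanishes on \<open>E\<close>.\<close>
  have mid: "\<mu> \<le> norm (w - q)"
    if w: "w \<in> closed_segment (x + \<mu> *\<^sub>R g) (y + \<mu> *\<^sub>R g)" and q: "q \<in> E" for w q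
  proof -
    obtain u where u: "0 \<le> u" "u \<le> 1" "w = (1 - u) *\<^sub>R (x + \<mu> *\<^sub>R g) + u *\<^sub>R (y + \<mu> *\<^sub>R g)"
      using w by (auto simp: closed_segment_def)
    have "w - x0 = (1 - u) *\<^sub>R (x - x0) + u *\<^sub>R (y - x0) + \<mu> *\<^sub>R g"
      unfolding u(3) by (simp add: algebra_simps)
    then have "(w - x0) \<bullet> g = (1 - u) * ((x - x0) \<bullet> g) + u * ((y - x0) \<bullet> g) + \<mu>"
      using g(1) by (simp add: inner_add_left power2_norm_eq_inner[symmetric])
    then have "\<mu> \<le> (w - x0) \<bullet> g" using u side by simp
    also have "\<dots> = (w - q) \<bullet> g" using inner_diff_E[OF q g(2)] by simp
    also have "\<dots> \<le> norm (w - q)" using norm_cauchy_schwarz[of "w - q" g] g(1) by simp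
    finally show ?thesis .
  qed
  have R': "norm (x - x0) \<le> 3 * d / 4" "norm (y - x0) \<le> 3 * d / 4" using R \<mu> by auto
  have "polygonal_cost G x (x + \<mu> *\<^sub>R g) (norm (x + \<mu> *\<^sub>R g - x) / \<mu>)"
    using R'(1) near[OF R(1)] \<mu> push[OF side(1) far(1)] by (rule polygonal_cost_segment_central)
  then have 1: "polygonal_cost G x (x + \<mu> *\<^sub>R g) 1" using g(1) \<mu> by simp
  have 2: "polygonal_cost G (x + \<mu> *\<^sub>R g) (y + \<mu> *\<^sub>R g) (norm (y + \<mu> *\<^sub>R g - (x + \<mu> *\<^sub>R g)) / \<mu>)"
    using near[OF R(1)] near[OF R(2)] \<mu> mid by (rule polygonal_cost_segment_central)
  have "polygonal_cost G (y + \<mu> *\<^sub>R g) y (norm (y - (y + \<mu> *\<^sub>R g)) / \<mu>)"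
    using near[OF R(2)] R'(2) \<mu> push[OF side(2) far(2)]
    by (rule polygonal_cost_segment_central) (simp_all add: closed_segment_commute)
  then have 3: "polygonal_cost G (y + \<mu> *\<^sub>R g) y 1" using g(1) \<mu> by simp
  show ?thesis
    using polygonal_cost_trans[OF 3 polygonal_cost_trans[OF 2 1]] \<mu>
    by (simp add: field_simps norm_minus_commute)
qed

text \<open>Points on different sides of the line carrying \<open>E\<close> are joined through a gap of \<open>E\<close>. In the
  plane the line cannot be avoided.\<close>
lemma polygonal_cost_central:
  assumes \<mu>: "0 < \<mu>"
    and far: "\<And>q. q \<in> E \<Longrightarrow> \<mu> \<le> norm (x - q)" "\<And>q. q \<in> E \<Longrightarrow> \<mu> \<le> norm (y - q)"
    and R: "norm (x - x0) \<le> R" "norm (y - x0) \<le> R" "R + 3 * \<mu> \<le> 3 * d / 4"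
  shows "polygonal_cost G x y (8 * norm (x - y) / \<mu> + 40)"
proof -
  have R0: "0 \<le> R" using R(1) norm_ge_zero order_trans by blast
  then have \<mu>d: "\<mu> \<le> d / 4" using R(3) by simp
  \<comment> \<open>The sign of \<open>f\<close> is chosen so that \<open>x\<close> is on the
    nonnegative side.\<close>
  obtain g where g: "norm g = 1" "e \<bullet> g = 0" "0 \<le> (x - x0) \<bullet> g"
  proof (cases "0 \<le> (x - x0) \<bullet> f")
    case True then show ?thesis using that f ef by blast
  next
    case False then show ?thesis using that[of "- f"] f ef by simp
  qed
  show ?thesis
  proof (cases "0 \<le> (y - x0) \<bullet> g")
    case True
    have "polygonal_cost G x y ((norm (x - y) + 2 * \<mu>) / \<mu>)"
      using g True \<mu> \<mu>d far R(1,2) by (rule polygonal_cost_same_side) (use R \<mu> in auto)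
    moreover have "(norm (x - y) + 2 * \<mu>) / \<mu> = norm (x - y) / \<mu> + 2" using \<mu> by (simp add: field_simps)
    moreover have "0 \<le> norm (x - y) / \<mu>" using \<mu> by simp
    ultimately show ?thesis by (elim polygonal_cost_mono) simp
  next
    case False
    \<comment> \<open>The parameter at which the segment from \<open>x\<close> to \<open>y\<close>
      crosses the hyperplane through \<open>x0\<close> orthogonal to \<open>g\<close>.\<close>
    define u where "u = (x - x0) \<bullet> g / ((x - x0) \<bullet> g - (y - x0) \<bullet> g)"
    have u: "0 \<le> u" "u \<le> 1" using g(3) False by (auto simp: u_def divide_simps)
    define z0 where "z0 = (1 - u) *\<^sub>R x + u *\<^sub>R y"
    have z0: "z0 \<in> closed_segment x y" using u by (auto simp: z0_def closed_segment_def)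
    have "z0 - x0 = (1 - u) *\<^sub>R (x - x0) + u *\<^sub>R (y - x0)" by (simp add: z0_def algebra_simps)
    then have "(z0 - x0) \<bullet> g = (1 - u) * ((x - x0) \<bullet> g) + u * ((y - x0) \<bullet> g)"
      by (simp add: inner_add_left)
    also have "\<dots> = (x - x0) \<bullet> g - u * ((x - x0) \<bullet> g - (y - x0) \<bullet> g)" by (simp add: algebra_simps)
    also have "\<dots> = 0" using g(3) False by (simp add: u_def)
    finally have z0g: "(z0 - x0) \<bullet> g = 0" .
    \<comment> \<open>Sliding the crossing point along \<open>e\<close> into a gap keeps it in the
      hyperplane, and its \<open>e\<close>-coordinate alone keeps it \<open>\<mu> / 8\<close> away
      from \<open>E\<close>.\<close>
    obtain b where b: "\<bar>b - (z0 - x0) \<bullet> e\<bar> \<le> 2 * \<mu>" "\<mu> / 8 \<le> \<bar>b\<bar>"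
      "\<And>k::nat. \<mu> / 8 \<le> \<bar>b - d / 2 ^ k\<bar>"
      using geometric_sequence_gap[OF d_pos \<mu>] by blast
    define z where "z = z0 + (b - (z0 - x0) \<bullet> e) *\<^sub>R e"
    have zz0: "norm (z - z0) \<le> 2 * \<mu>" using b(1) e by (simp add: z_def)
    have zg: "(z - x0) \<bullet> g = 0" using z0g g(2) by (simp add: z_def inner_diff_left inner_add_left)
    have ee: "e \<bullet> e = 1" using e by (simp add: power2_norm_eq_inner[symmetric])
    have zfar: "\<mu> / 8 \<le> norm (z - q)" if q: "q \<in> E" for q
    proof -
      obtain \<sigma> where \<sigma>: "q = x0 + \<sigma> *\<^sub>R e" "\<sigma> = 0 \<or> (\<exists>k. \<sigma> = d / 2 ^ k)"
        using q by (rule E_coord) blast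
      have "(z - q) \<bullet> e = b - \<sigma>"
        using ee by (simp add: z_def \<sigma>(1) inner_diff_left inner_add_left)
      moreover have "\<mu> / 8 \<le> \<bar>b - \<sigma>\<bar>" using \<sigma>(2) b by auto
      moreover have "\<bar>(z - q) \<bullet> e\<bar> \<le> norm (z - q)" using Cauchy_Schwarz_ineq2[of "z - q" e] e by simp
      ultimately show ?thesis by simp
    qed
    have "closed_segment x y \<subseteq> cball x0 R"
      using R by (intro closed_segment_subset) (auto simp: dist_norm norm_minus_commute)
    then have "norm (z0 - x0) \<le> R" using z0 by (auto simp: dist_norm norm_minus_commute)
    then have zR: "norm (z - x0) \<le> R + 2 * \<mu>"
      using norm_triangle_ineq[of "z - z0" "z0 - x0"] zz0 by simp
    \<comment> \<open>The point \<open>z\<close> in the hyperplane counts as lying on both sides.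
      The bound on \<open>R\<close> leaves room for the slide by \<open>2 * \<mu>\<close> and a push
      by \<open>\<mu> / 8\<close>.\<close>
    have 1: "polygonal_cost G x z ((norm (x - z) + 2 * (\<mu> / 8)) / (\<mu> / 8))"
      by (rule polygonal_cost_same_side[OF g, where R = "R + 2 * \<mu>"])
        (use \<mu> \<mu>d far zfar R zR zg in force)+
    have 2: "polygonal_cost G z y ((norm (z - y) + 2 * (\<mu> / 8)) / (\<mu> / 8))"
      by (rule polygonal_cost_same_side[where g = "- g" and R = "R + 2 * \<mu>"])
        (use g False \<mu> \<mu>d far zfar R zR zg in force)+
    have "norm (x - z0) + norm (z0 - y) = norm (x - y)"
    proof -
      have "x - z0 = u *\<^sub>R (x - y)" "z0 - y = (1 - u) *\<^sub>R (x - y)" by (simp_all add: z0_def algebra_simps)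
      then have "norm (x - z0) = u * norm (x - y)" "norm (z0 - y) = (1 - u) * norm (x - y)" using u by simp_all
      then show ?thesis by (simp add: left_diff_distrib)
    qed
    moreover have "norm (x - z) \<le> norm (x - z0) + norm (z - z0)"
      using norm_triangle_ineq4[of "x - z0" "z - z0"] by simp
    moreover have "norm (z - y) \<le> norm (z - z0) + norm (z0 - y)"
      using norm_triangle_ineq[of "z - z0" "z0 - y"] by simp
    ultimately have len: "norm (x - z) + norm (z - y) \<le> norm (x - y) + 4 * \<mu>" using zz0 by simp
    have "(norm (x - z) + 2 * (\<mu> / 8)) / (\<mu> / 8) + (norm (z - y) + 2 * (\<mu> / 8)) / (\<mu> / 8)
        = 8 * (norm (x - z) + norm (z - y)) / \<mu> + 4"
      using \<mu> by (simp add: field_simps)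
    also have "\<dots> \<le> 8 * (norm (x - y) + 4 * \<mu>) / \<mu> + 4"
      using len \<mu> by (intro add_right_mono divide_right_mono mult_left_mono) auto
    also have "\<dots> \<le> 8 * norm (x - y) / \<mu> + 40" using \<mu> by (simp add: field_simps)
    finally show ?thesis using polygonal_cost_trans[OF 2 1] polygonal_cost_mono by blast
  qed
qed

section \<open>Moving chains away from the centre, and the global estimate\<close>

text \<open>Not continuous: the whole open ball of radius \<open>d / 4\<close> goes to one base
  point, on the ray opposite to \<open>E\<close>.\<close>

definition retract :: "'a \<Rightarrow> 'a" where
  "retract z = (if d / 4 \<le> norm (z - x0) then z else x0 - (d / 4) *\<^sub>R e)"

lemma norm_retract:
  "d / 4 \<le> norm (retract z - x0)" "norm (retract z - x0) \<le> max (norm (z - x0)) (d / 4)"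
  using e d_pos by (auto simp: retract_def)

lemma norm_diff_E_ge:
  assumes "d / 4 \<le> norm (z - x0)" "q \<in> E"
  shows "norm (z - x0) / 2 \<le> norm (z - q)"
  using norm_E_le[OF assms(2)] norm_triangle_ineq[of "z - q" "q - x0"] assms(1) by simp

text \<open>If the segment enters the central ball, everything happens at scale \<open>d\<close> and
  the central estimate applies. Otherwise \<open>retract\<close> fixes both ends, and the distance
  to \<open>E\<close> along the segment is comparable to the distance from \<open>x0\<close>, hence
  at least a fixed fraction of \<open>bdist D z\<close>.\<close>

lemma polygonal_cost_retract_near_pair:
  assumes "(z, w) \<in> near_pairs D"
  shows "polygonal_cost G (retract z) (retract w) 500"
proof (cases "\<exists>p\<in>closed_segment z w. norm (p - x0) < d / 4")
  case True
  then obtain p where p: "p \<in> closed_segment z w" "norm (p - x0) < d / 4" by blast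
  have zw: "norm (w - z) \<le> bdist D z / 4" using assms by (simp add: near_pairs_def)
  have pz: "norm (p - z) \<le> norm (w - z)" "norm (p - w) \<le> norm (w - z)"
    using norm_diff_le_of_mem_closed_segment[OF p(1)] by auto
  have "bdist D p \<le> d + norm (p - x0)" using bdist_le_bdist_add[of D p x0] d_eq by simp
  moreover have "bdist D z \<le> bdist D p + norm (p - z)"
    using bdist_le_bdist_add[of D z p] by (simp add: norm_minus_commute)
  \<comment> \<open>Here \<open>bdist D z\<close> is at most \<open>5 * d / 4\<close> plus a quarter
    of itself, hence at most \<open>5 * d / 3\<close>.\<close>
  ultimately have zw': "norm (w - z) \<le> 5 * d / 12" using p(2) zw pz(1) by simp
  have "norm (z - x0) \<le> norm (p - z) + norm (p - x0)" "norm (w - x0) \<le> norm (p - w) + norm (p - x0)"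
    using norm_triangle_ineq4[of "p - x0" "p - z"] norm_triangle_ineq4[of "p - x0" "p - w"] by simp_all
  then have near: "norm (z - x0) \<le> 2 * d / 3" "norm (w - x0) \<le> 2 * d / 3"
    using p(2) pz zw' by simp_all
  have R: "norm (retract z - x0) \<le> 2 * d / 3" "norm (retract w - x0) \<le> 2 * d / 3"
    using norm_retract(2)[of z] norm_retract(2)[of w] near d_pos by linarith+
  \<comment> \<open>The scale \<open>d / 40\<close> fits the central estimate, since
    \<open>2 * d / 3 + 3 * d / 40\<close> is below \<open>3 * d / 4\<close>.\<close>
  have far: "d / 40 \<le> norm (retract v - q)" if "q \<in> E" for v q
    using norm_diff_E_ge[OF norm_retract(1) that, of v] norm_retract(1)[of v] d_pos by linarith
  have "polygonal_cost G (retract z) (retract w) (8 * norm (retract z - retract w) / (d / 40) + 40)"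
    by (rule polygonal_cost_central[OF _ far far R]) (use d_pos in auto)
  moreover have "norm (retract z - retract w) \<le> 4 * d / 3"
    using norm_triangle_ineq4[of "retract z - x0" "retract w - x0"] R by simp
  then have "8 * norm (retract z - retract w) / (d / 40) + 40 \<le> 500"
    using d_pos by (simp add: field_simps)
  ultimately show ?thesis by (rule polygonal_cost_mono)
next
  case False
  then have out: "d / 4 \<le> norm (p - x0)" if "p \<in> closed_segment z w" for p
    using that by force
  have ret: "retract z = z" "retract w = w" using out[of z] out[of w] by (auto simp: retract_def)
  have zD: "z \<in> D" and zw: "norm (w - z) \<le> bdist D z / 4" using assms by (auto simp: near_pairs_def)
  have zpos: "0 < bdist D z" by (rule bdist_pos[OF open_D dom(2) zD])
  have ge: "p \<in> G" "3 * bdist D z / 40 \<le> bdist G p" if p: "p \<in> closed_segment z w" for p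
  proof -
    have pz: "norm (p - z) \<le> bdist D z / 4"
      using norm_diff_le_of_mem_closed_segment[OF p] zw by simp
    have pD: "p \<in> D"
      by (rule in_if_norm_less_bdist[OF open_D dom(2) zD]) (use pz zpos in simp)
    have le: "3 * bdist D z / 4 \<le> bdist D p"
      using bdist_le_bdist_add[of D z p] pz by (simp add: norm_minus_commute)
    have "bdist D p \<le> d + norm (p - x0)" using bdist_le_bdist_add[of D p x0] d_eq by simp
    \<comment> \<open>Combined with \<open>norm_diff_E_ge\<close> this makes the distance to
      \<open>E\<close> at least \<open>bdist D p / 10\<close>, and \<open>bdist D p\<close> is at
      least \<open>3 / 4\<close> of \<open>bdist D z\<close>; hence \<open>3 / 40\<close>.\<close>
    then have "bdist D p \<le> 5 * norm (p - x0)" using out[OF p] by simp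
    then have "3 * bdist D z / 40 \<le> norm (p - q)" if "q \<in> E" for q
      using norm_diff_E_ge[OF out[OF p] that] le by simp
    then show "p \<in> G" "3 * bdist D z / 40 \<le> bdist G p"
      using bdist_G_ge[OF pD, of "3 * bdist D z / 40"] le zpos by auto
  qed
  have "norm (w - z) / (3 * bdist D z / 40) \<le> 500"
    using zw zpos by (simp add: field_simps)
  then show ?thesis
    unfolding ret using ge zpos by (intro polygonal_cost_segment[where r = "3 * bdist D z / 40"]) auto
qed

lemma retract_in_G: "z \<in> D \<Longrightarrow> retract z \<in> G"
proof -
  assume z: "z \<in> D"
  have "retract z \<in> D"
    using z e d_pos central_ball(1)[of "x0 - (d / 4) *\<^sub>R e"] by (auto simp: retract_def)
  moreover have "retract z \<notin> E"
    using norm_E_le[of "retract z"] norm_retract(1)[of z] d_pos by auto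
  ultimately show ?thesis by (simp add: G_eq)
qed

lemma polygonal_cost_retract_chain:
  assumes "(x, y) \<in> near_pairs D ^^ k" "x \<in> D"
  shows "polygonal_cost G (retract x) (retract y) (500 * real k)"
  using assms
proof (induction k arbitrary: y)
  case 0
  then show ?case using retract_in_G by (auto intro: polygonal_cost.refl)
next
  case (Suc k)
  then obtain z where "(x, z) \<in> near_pairs D ^^ k" and zy: "(z, y) \<in> near_pairs D" by auto
  then have "polygonal_cost G (retract x) (retract z) (500 * real k)" using Suc by blast
  from polygonal_cost_trans[OF polygonal_cost_retract_near_pair[OF zy] this]
  show ?case by (simp add: algebra_simps)
qed

text \<open>For small \<open>t\<close> a segment suffices. Otherwise \<open>1 \<le> 2 * t\<close>
  absorbs additive constants, and the points are joined either directly near \<open>x0\<close> or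
  through a retracted chain.\<close>

lemma qh_dist_G_le:
  assumes xy: "x \<in> G" "y \<in> G" and M: "0 \<le> M" "qh_dist D x y \<le> M"
  defines "t \<equiv> norm (x - y) / min (bdist G x) (bdist G y)"
  shows "qh_dist G x y \<le> 8000 * (t + M)"
proof -
  define m where "m = min (bdist G x) (bdist G y)"
  have m: "0 < m" using bdist_pos[OF open_G G_neq_UNIV] xy by (auto simp: m_def)
  have t: "norm (x - y) = t * m" "0 \<le> t" using m by (auto simp: t_def m_def)
  have xyD: "x \<in> D" "y \<in> D" using xy by (auto simp: G_eq)
  have far: "m \<le> norm (x - q)" "m \<le> norm (y - q)" if "q \<in> E" for q
    using bdist_G_le(2)[OF xy(1) that] bdist_G_le(2)[OF xy(2) that] by (auto simp: m_def)
  \<comment> \<open>The scale \<open>m / 8\<close> leaves room in the central estimate with radius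
    \<open>d / 2\<close>: there \<open>m \<le> d / 2\<close>, so \<open>3 * m / 8\<close> is below
    \<open>d / 4\<close>.\<close>
  have far8: "m / 8 \<le> norm (x - q)" "m / 8 \<le> norm (y - q)" if "q \<in> E" for q
    using far[OF that] m by linarith+
  have "\<exists>c. polygonal_cost G x y c \<and> c \<le> 8000 * (t + M)"
  proof (cases "t < 1 / 2")
    case True
    have "t * m \<le> 1 / 2 * m" using True m by (intro mult_right_mono) auto
    moreover have mx: "m \<le> bdist G x" by (simp add: m_def)
    ultimately have "norm (y - x) \<le> bdist G x / 2"
      using t(1) by (simp add: norm_minus_commute)
    from polygonal_cost_near[OF open_G G_neq_UNIV xy(1) this]
    have "polygonal_cost G x y (2 * norm (y - x) / bdist G x)" .
    moreover have "2 * norm (y - x) / bdist G x \<le> 2 * norm (y - x) / m"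
      using m mx by (intro divide_left_mono mult_pos_pos) auto
    moreover have "2 * norm (y - x) / m = 2 * t" using t(1) m by (simp add: norm_minus_commute)
    ultimately show ?thesis using t(2) M(1) by (intro exI conjI) auto
  next
    case False
    then have t2: "1 \<le> 2 * t" by simp
    show ?thesis
    proof (cases "norm (x - y) < d / 4 \<and> (norm (x - x0) < d / 4 \<or> norm (y - x0) < d / 4)")
      case True
      then have R: "norm (x - x0) \<le> d / 2" "norm (y - x0) \<le> d / 2"
        using norm_triangle_ineq[of "x - y" "y - x0"] norm_triangle_ineq4[of "x - x0" "x - y"] by auto
      have "m \<le> d / 2" using far(1)[OF x0_in_E] R(1) by simp
      then have "polygonal_cost G x y (8 * norm (x - y) / (m / 8) + 40)"
        using m far8 by (intro polygonal_cost_central[OF _ _ _ R]) auto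
      moreover have "8 * norm (x - y) / (m / 8) + 40 = 64 * t + 40" using t(1) m by simp
      ultimately show ?thesis using t2 M(1) by (intro exI conjI) auto
    next
      case False
      have ret: "polygonal_cost G x (retract x) (128 * t + 40)" "polygonal_cost G (retract y) y (128 * t + 40)"
      proof -
        \<comment> \<open>In this case a point within \<open>d / 4\<close> of \<open>x0\<close>
          forces \<open>d / 4 \<le> norm (x - y)\<close>. Moving it to the base point covers at most
          \<open>d / 2\<close>, hence at most \<open>2 * t * m\<close>.\<close>
        have *: "polygonal_cost G z (retract z) (128 * t + 40) \<and> polygonal_cost G (retract z) z (128 * t + 40)"
          if z: "z \<in> G" "\<And>q. q \<in> E \<Longrightarrow> m \<le> norm (z - q)"
            and d: "norm (z - x0) < d / 4 \<Longrightarrow> d / 4 \<le> norm (x - y)" for z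
        proof (cases "d / 4 \<le> norm (z - x0)")
          case True
          then show ?thesis using t(2) z by (auto simp: retract_def intro: polygonal_cost.refl)
        next
          case False
          have far_z: "m / 8 \<le> norm (z - q)" if "q \<in> E" for q using z(2)[OF that] m by simp
          have md: "m \<le> d / 4" using z(2)[OF x0_in_E] False by simp
          have far_r: "m / 8 \<le> norm (retract z - q)" if "q \<in> E" for q
            using norm_diff_E_ge[OF norm_retract(1) that, of z] norm_retract(1)[of z] md d_pos by linarith
          have R: "norm (z - x0) \<le> d / 4" "norm (retract z - x0) \<le> d / 4"
            using False norm_retract(2)[of z] by auto
          have "norm (z - retract z) \<le> d / 2"
            using norm_triangle_ineq4[of "z - x0" "retract z - x0"] R by simp
          then have "norm (z - retract z) \<le> 2 * (t * m)" using d False t(1) by simp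
          then have "64 * norm (z - retract z) / m \<le> 64 * (2 * (t * m)) / m"
            using m by (intro divide_right_mono) linarith+
          also have "\<dots> = 128 * t" using m by simp
          finally have c: "8 * norm (z - retract z) / (m / 8) + 40 \<le> 128 * t + 40" by simp
          have \<mu>: "0 < m / 8" "d / 4 + 3 * (m / 8) \<le> 3 * d / 4" using m md d_pos by auto
          have "polygonal_cost G z (retract z) (8 * norm (z - retract z) / (m / 8) + 40)"
            by (rule polygonal_cost_central[OF \<mu>(1) far_z far_r R \<mu>(2)])
          moreover have "polygonal_cost G (retract z) z (8 * norm (z - retract z) / (m / 8) + 40)"
            unfolding norm_minus_commute[of z]
            by (rule polygonal_cost_central[OF \<mu>(1) far_r far_z R(2,1) \<mu>(2)])
          ultimately show ?thesis using c by (blast intro: polygonal_cost_mono)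
        qed
        show "polygonal_cost G x (retract x) (128 * t + 40)"
          using *[OF xy(1) far(1)] False by auto
        show "polygonal_cost G (retract y) y (128 * t + 40)"
          using *[OF xy(2) far(2)] False by auto
      qed
      obtain k where k: "real k \<le> 5 * M + 7" "(x, y) \<in> near_pairs D ^^ k"
        using qh_dist_chain[OF dom xyD M(2)] by blast
      note chain = polygonal_cost_retract_chain[OF k(2) xyD(1)]
      \<comment> \<open>The total is at most \<open>256 * t + 80 + 500 * (5 * M + 7)\<close>; the
        constant 3580 is absorbed by \<open>7160 * t\<close>.\<close>
      show ?thesis
        using polygonal_cost_trans[OF ret(2) polygonal_cost_trans[OF chain ret(1)]] k(1) t2 M(1)
        by (intro exI conjI) auto
    qed
  qed
  then show ?thesis using qh_dist_le_polygonal_cost[OF _ open_G G_neq_UNIV] by fastforce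
qed

end

section \<open>The control function, the shape of the sequence, and the conclusion\<close>

text \<open>A continuous injection on an interval is strictly monotone; it cannot decrease here
  because the value \<open>\<phi> 0 + 1\<close> is attained.\<close>

lemma halfline_homeo_strict_mono:
  assumes "halfline_homeo \<phi>"
  shows "strict_mono_on {0..} \<phi>" "continuous_on {0..} \<phi>" "\<phi> ` {0..} = {0..}"
proof -
  obtain \<phi>' where h: "homeomorphism {0..} {0..} \<phi> \<phi>'" using assms by (auto simp: halfline_homeo_def)
  show c: "continuous_on {0..} \<phi>" and im: "\<phi> ` {0..} = {0..}" using h by (auto simp: homeomorphism_def)
  have "inj_on \<phi> {0..}" using h by (metis homeomorphism_apply1 inj_on_inverseI)
  then consider "strict_mono_on {0..} \<phi>" | "strict_antimono_on {0..} \<phi>"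
    using injective_eq_monotone_map[of "{0..}" \<phi>] c by (auto simp: is_interval_ci)
  then show "strict_mono_on {0..} \<phi>"
  proof cases
    case 2
    have "0 \<le> \<phi> 0" using im by auto
    then have "\<phi> 0 + 1 \<in> \<phi> ` {0..}" using im by auto
    then obtain s where s: "0 \<le> s" "\<phi> s = \<phi> 0 + 1" by auto
    then have "0 < s" by (cases "s = 0") auto
    then have "\<phi> s < \<phi> 0" using 2 by (auto simp: monotone_on_def)
    then show ?thesis using s by simp
  qed
qed

text \<open>The map vanishes at 0 and is at least \<open>v\<close> at \<open>v / C\<close>, so the
  intermediate value theorem gives surjectivity; injectivity on a path-connected subset of the line
  makes the inverse continuous.\<close>

lemma halfline_homeo_scaled_add_id:
  assumes "halfline_homeo \<phi>" "0 < C"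
  shows "halfline_homeo (\<lambda>t. C * (t + \<phi> t))"
proof -
  note \<phi> = halfline_homeo_strict_mono[OF assms(1)]
  let ?\<psi> = "\<lambda>t. C * (t + \<phi> t)"
  have c: "continuous_on {0..} ?\<psi>" using \<phi>(2) by (intro continuous_intros)
  have nn: "0 \<le> \<phi> t" if "0 \<le> t" for t using \<phi>(3) that by auto
  have mono: "?\<psi> s < ?\<psi> t" if "0 \<le> s" "s < t" for s t
    using strict_mono_onD[OF \<phi>(1), of s t] that assms(2) by simp
  then have inj: "inj_on ?\<psi> {0..}"
    by (intro inj_onI) (metis atLeast_iff less_irrefl linorder_neqE_linordered_idom)
  have \<phi>0: "\<phi> 0 = 0"
  proof -
    obtain s where s: "0 \<le> s" "\<phi> s = 0" using \<phi>(3) by (metis atLeast_iff imageE order_refl)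
    then have "\<phi> 0 \<le> \<phi> s" using strict_mono_onD[OF \<phi>(1), of 0 s] by (cases "s = 0") auto
    then show ?thesis using s nn[of 0] by simp
  qed
  have "?\<psi> ` {0..} = {0..}"
  proof safe
    fix t :: real assume "0 \<le> t"
    then show "0 \<le> ?\<psi> t" using nn[of t] assms(2) by simp
  next
    fix v :: real assume v: "0 \<le> v"
    have "\<exists>t. 0 \<le> t \<and> t \<le> v / C \<and> ?\<psi> t = v"
    proof (rule IVT')
      show "?\<psi> 0 \<le> v" using v \<phi>0 by simp
      show "v \<le> ?\<psi> (v / C)" using nn[of "v / C"] v assms(2) by (simp add: field_simps)
      show "continuous_on {0..v / C} ?\<psi>" using c by (rule continuous_on_subset) auto
    qed (use v assms(2) in auto)
    then show "v \<in> ?\<psi> ` {0..}" by auto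
  qed
  moreover have "path_connected {0::real..}"
    by (intro convex_imp_path_connected) auto
  ultimately show ?thesis
    using injective_into_1d_eq_homeomorphism[OF c] inj unfolding halfline_homeo_def by metis
qed

text \<open>Each point lies on the segment from \<open>x0\<close> to its predecessor at half the
  distance, so the whole sequence stays on the ray through \<open>x 1\<close>. The factor
  \<open>8 / d\<close> normalizes \<open>x 1 - x0\<close>.\<close>

lemma halving_sequence_eq:
  fixes x :: "nat \<Rightarrow> 'a::euclidean_space"
  assumes d: "0 < d"
    and seg: "\<forall>k\<ge>2. x k \<in> closed_segment x0 (x (k - 1)) - {x (k - 1)}"
    and nrm: "\<forall>k\<ge>1. norm (x0 - x k) = 1 / 2 ^ (k + 2) * d"
  shows "x (Suc k) = x0 + (d / 2 ^ (k + 3)) *\<^sub>R ((8 / d) *\<^sub>R (x 1 - x0))"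
proof (induction k)
  case 0
  then show ?case using d by simp
next
  case (Suc k)
  have "x (Suc (Suc k)) \<in> closed_segment x0 (x (Suc k))" using seg[rule_format, of "Suc (Suc k)"] by simp
  then obtain u where u: "0 \<le> u" "x (Suc (Suc k)) = (1 - u) *\<^sub>R x0 + u *\<^sub>R x (Suc k)"
    by (auto simp: closed_segment_def)
  then have eq: "x (Suc (Suc k)) - x0 = u *\<^sub>R (x (Suc k) - x0)" by (simp add: algebra_simps)
  then have "norm (x0 - x (Suc (Suc k))) = u * norm (x0 - x (Suc k))"
    using u(1) by (metis abs_of_nonneg norm_minus_commute norm_scaleR)
  then have "u = 1 / 2" using nrm d by (simp add: field_simps)
  then have "x (Suc (Suc k)) = x0 + (1 / 2) *\<^sub>R (x (Suc k) - x0)" using eq by (metis add.commute diff_add_cancel)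
  also have "\<dots> = x0 + (d / 2 ^ (Suc k + 3)) *\<^sub>R ((8 / d) *\<^sub>R (x 1 - x0))"
    unfolding Suc.IH by (simp add: power_add)
  finally show ?case .
qed

theorem theorem4p19:
  fixes \<phi> :: "real \<Rightarrow> real"
  assumes "CARD('n::finite) \<ge> 2"
    and "halfline_homeo \<phi>"
  shows "\<exists>\<psi>. halfline_homeo \<psi> \<and>
    (\<forall>(D :: (real ^ 'n) set) x0 (x :: nat \<Rightarrow> real ^ 'n).
       uniform_domain \<phi> D \<and> x0 \<in> D \<and>
       (\<forall>k\<ge>1. x k \<in> ball x0 (bdist D x0)) \<and>
       (\<forall>k\<ge>2. x k \<in> closed_segment x0 (x (k - 1)) - {x (k - 1)}) \<and>
       (\<forall>k\<ge>1. norm (x0 - x k) = 1 / 2 ^ (k + 2) * bdist D x0)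
       \<longrightarrow> uniform_domain \<psi> (D - ({x0} \<union> x ` {1..})))"
proof (intro exI conjI allI impI)
  \<comment> \<open>Fixed before \<open>D\<close>, \<open>x0\<close> and the sequence, so it depends
    on \<phi> alone.\<close>
  let ?\<psi> = "\<lambda>t. 8000 * (t + \<phi> t)"
  show "halfline_homeo ?\<psi>" using assms(2) by (rule halfline_homeo_scaled_add_id) simp
  note \<phi> = halfline_homeo_strict_mono[OF assms(2)]
  fix D :: "(real ^ 'n) set" and x0 and x :: "nat \<Rightarrow> real ^ 'n"
  assume "uniform_domain \<phi> D \<and> x0 \<in> D \<and>
       (\<forall>k\<ge>1. x k \<in> ball x0 (bdist D x0)) \<and>
       (\<forall>k\<ge>2. x k \<in> closed_segment x0 (x (k - 1)) - {x (k - 1)}) \<and>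
       (\<forall>k\<ge>1. norm (x0 - x k) = 1 / 2 ^ (k + 2) * bdist D x0)"
  then have D: "is_domain D" "D \<noteq> UNIV" "x0 \<in> D"
    and unif: "\<And>x y. \<lbrakk>x \<in> D; y \<in> D\<rbrakk> \<Longrightarrow>
      qh_dist D x y \<le> \<phi> (norm (x - y) / min (bdist D x) (bdist D y))"
    and seg: "\<forall>k\<ge>2. x k \<in> closed_segment x0 (x (k - 1)) - {x (k - 1)}"
    and nrm: "\<forall>k\<ge>1. norm (x0 - x k) = 1 / 2 ^ (k + 2) * bdist D x0"
    by (auto simp: uniform_domain_def)
  define d where "d = bdist D x0"
  define e where "e = (8 / d) *\<^sub>R (x 1 - x0)"
  define E where "E = {x0} \<union> x ` {1..}"
  define G where "G = D - E"
  have D': "open D" "connected D" using D(1) by (auto simp: is_domain_def)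
  have d: "0 < d" unfolding d_def by (rule bdist_pos[OF D'(1) D(2,3)])
  have dim: "2 \<le> DIM(real ^ 'n)" using assms(1) by simp
  have "norm (x 1 - x0) = d / 8" using nrm by (simp add: d_def norm_minus_commute)
  then have e: "norm e = 1" using d by (simp add: e_def)
  obtain f0 where f0: "f0 \<noteq> 0" "orthogonal e f0" by (rule orthogonal_to_vector_exists[OF dim])
  have "x ` {1..} = range (\<lambda>k. x (Suc k))"
    by (auto simp: image_iff) (metis Suc_le_D)
  also have "\<dots> = range (\<lambda>k. x0 + (d / 2 ^ (k + 3)) *\<^sub>R e)"
    unfolding halving_sequence_eq[OF d seg nrm[folded d_def]] e_def ..
  finally have E: "E = insert x0 (range (\<lambda>k. x0 + (d / 2 ^ (k + 3)) *\<^sub>R e))" by (simp add: E_def)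
  interpret punctured_domain D x0 e "f0 /\<^sub>R norm f0" d E G
    by standard (use D e f0 E in \<open>auto simp: d_def G_def orthogonal_def\<close>)
  \<comment> \<open>In dimension at least 2, removing countably many points from a connected open
    set leaves it connected.\<close>
  have "countable E" by (simp add: E_def)
  then have conn: "connected G" unfolding G_def
    by (rule connected_open_diff_countable[OF dim D'])
  moreover have "G \<noteq> {}" using retract_in_G[OF D(3)] by blast
  ultimately have "is_domain G" using open_G by (simp add: is_domain_def)
  moreover have "qh_dist G u v \<le> ?\<psi> (norm (u - v) / min (bdist G u) (bdist G v))"
    if uv: "u \<in> G" "v \<in> G" for u v
  proof (rule qh_dist_G_le[OF uv])
    let ?t = "norm (u - v) / min (bdist G u) (bdist G v)"
      and ?t' = "norm (u - v) / min (bdist D u) (bdist D v)"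
    have pos: "0 < min (bdist G u) (bdist G v)" using uv bdist_pos[OF open_G G_neq_UNIV] by auto
    \<comment> \<open>Removing points only shrinks boundary distances, so the argument of the
      increasing \<phi> grows. Thus \<open>\<phi> ?t\<close> can play the part of
      \<open>M\<close>.\<close>
    have le: "min (bdist G u) (bdist G v) \<le> min (bdist D u) (bdist D v)"
      using bdist_G_le(1)[OF uv(1)] bdist_G_le(1)[OF uv(2)] by auto
    have "?t' \<le> ?t" using pos le by (intro divide_left_mono mult_pos_pos) auto
    moreover have "0 \<le> ?t'" "0 \<le> ?t" by (simp_all add: bdist_nonneg)
    ultimately have "\<phi> ?t' \<le> \<phi> ?t"
      using strict_mono_onD[OF \<phi>(1), of ?t' ?t] by (cases "?t' = ?t") auto
    moreover have "qh_dist D u v \<le> \<phi> ?t'" using uv by (intro unif) (auto simp: G_def)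
    ultimately show "qh_dist D u v \<le> \<phi> ?t" by simp
    show "0 \<le> \<phi> ?t" using \<phi>(3) \<open>0 \<le> ?t\<close> by auto
  qed
  ultimately have "uniform_domain ?\<psi> G" using G_neq_UNIV by (simp add: uniform_domain_def)
  then show "uniform_domain ?\<psi> (D - ({x0} \<union> x ` {1..}))" by (simp add: G_def E_def)
qed

end
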